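(* Let $\mathbb{F}$ be a field of characteristic $0$, let $W$ be a group, and let $\rho: W \to \operatorname{GL}(V)$ be a representation of $W$ on an $n$-dimensional vector space $V$ over $\mathbb{F}$. Let $k \ge 1$ and suppose that $s_1, \dots, s_k \in W$ satisfy: (1) for each $i$, $s_i$ acts on $V$ (via $\rho$) by a (generalized) reflection with reflection vector $\alpha_i$ of eigenvalue $\lambda_i$; (2) the group $W$ is generated by $\{s_1, \dots, s_k\}$; (3) the representation $(V,\rho)$ is irreducible; (4) for any pair $i,j$ of indices in $\{1,\dots,k\}$, $s_i \cdot \alpha_j \ne \alpha_j$ if and only if $s_j \cdot \alpha_i \ne \alpha_i$. Then the $W$-modules $\bigwedge^d V$, $0 \le d \le n$, are irreducible and pairwise non-isomorphic (i.e. $\bigwedge^d V \not\simeq \bigwedge^{e} V$ as $W$-modules whenever $0 \le d \ne e \le n$).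
   Context: A linear map $s: V \to V$ on a finite-dimensional vector space $V$ over a field $\mathbb{F}$ is called a (generalized) reflection if $s$ is diagonalizable (over $\mathbb{F}$) and $\operatorname{rank}(s - \mathrm{Id}_V) = 1$. A reflection vector of a reflection $s$ is a nonzero vector $\alpha_s \in \operatorname{Im}(s - \mathrm{Id}_V)$; it satisfies $s \cdot \alpha_s = \lambda_s \alpha_s$ for some $\lambda_s \in \mathbb{F} \setminus \{1\}$, and $\lambda_s$ is its eigenvalue. (No invariant inner product is assumed, and reflections need not have order $2$.) The group $W$ acts on the exterior power $\bigwedge^d V$ by $w \cdot (v_1 \wedge \dots \wedge v_d) = (w \cdot v_1) \wedge \dots \wedge (w \cdot v_d)$; by convention $\bigwedge^0 V = \mathbb{F}$ is the one-dimensional trivial $W$-module. An irreducible (simple) module is in particular nonzero. *)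

theory Defs
  imports
    Complex_Main
    "HOL-Library.Poly_Mapping"
    "HOL-Algebra.AbelCoset"
    "HOL-Algebra.Module"
    "HOL-Algebra.Generated_Groups"
    "HOL-Algebra.Algebraic_Closure_Type"
begin

section \<open>Reflections\<close>

definition general_linear_group ::
  "('f::field \<Rightarrow> 'v::ab_group_add \<Rightarrow> 'v) \<Rightarrow> ('v \<Rightarrow> 'v) monoid" where
  "general_linear_group scale =
     \<lparr>carrier = {f. Vector_Spaces.linear scale scale f \<and> bij f}, monoid.mult = (\<circ>), one = id\<rparr>"

definition diagonalizable ::
  "('f::field \<Rightarrow> 'v::ab_group_add \<Rightarrow> 'v) \<Rightarrow> ('v \<Rightarrow> 'v) \<Rightarrow> bool" where
  "diagonalizable scale f \<longleftrightarrow>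
     (\<exists>B. \<not> module.dependent scale B \<and> module.span scale B = UNIV \<and>
        (\<forall>b\<in>B. \<exists>c. f b = scale c b))"

definition reflection ::
  "('f::field \<Rightarrow> 'v::ab_group_add \<Rightarrow> 'v) \<Rightarrow> ('v \<Rightarrow> 'v) \<Rightarrow> bool" where
  "reflection scale s \<longleftrightarrow>
     Vector_Spaces.linear scale scale s \<and> diagonalizable scale s \<and>
     vector_space.dim scale (range (\<lambda>v. s v - v)) = 1"

definition reflection_vector :: "('v::ab_group_add \<Rightarrow> 'v) \<Rightarrow> 'v \<Rightarrow> bool" where
  "reflection_vector s \<alpha> \<longleftrightarrow> \<alpha> \<noteq> 0 \<and> \<alpha> \<in> range (\<lambda>v. s v - v)"

section \<open>Modules over a group\<close>

text \<open>
  A linear representation of a group \<open>W\<close> over \<open>R\<close> is given by an \<open>R\<close>-module \<open>M\<close>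
  (over a field: a vector space) together with a linear action of \<open>W\<close> on its carrier.
\<close>

locale group_module = W?: group W + Module.module R M
  for W :: "('w, 'c) monoid_scheme" (structure)
    and R :: "('r, 'd) ring_scheme"
    and M :: "('r, 'm, 'e) module_scheme" +
  fixes act :: "'w \<Rightarrow> 'm \<Rightarrow> 'm"
  assumes act_closed: "\<lbrakk>w \<in> carrier W; x \<in> carrier M\<rbrakk> \<Longrightarrow> act w x \<in> carrier M"
    and act_add: "\<lbrakk>w \<in> carrier W; x \<in> carrier M; y \<in> carrier M\<rbrakk>
          \<Longrightarrow> act w (x \<oplus>\<^bsub>M\<^esub> y) = act w x \<oplus>\<^bsub>M\<^esub> act w y"
    and act_smult: "\<lbrakk>w \<in> carrier W; c \<in> carrier R; x \<in> carrier M\<rbrakk>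
          \<Longrightarrow> act w (c \<odot>\<^bsub>M\<^esub> x) = c \<odot>\<^bsub>M\<^esub> act w x"
    and act_one: "x \<in> carrier M \<Longrightarrow> act \<one>\<^bsub>W\<^esub> x = x"
    and act_mult: "\<lbrakk>v \<in> carrier W; w \<in> carrier W; x \<in> carrier M\<rbrakk>
          \<Longrightarrow> act (v \<otimes>\<^bsub>W\<^esub> w) x = act v (act w x)"

definition irreducible_module ::
  "('w, 'c) monoid_scheme \<Rightarrow> ('r, 'd) ring_scheme \<Rightarrow> ('r, 'm, 'e) module_scheme \<Rightarrow>
     ('w \<Rightarrow> 'm \<Rightarrow> 'm) \<Rightarrow> bool" where
  "irreducible_module W R M act \<longleftrightarrow>
     group_module W R M act \<and> carrier M \<noteq> {\<zero>\<^bsub>M\<^esub>} \<and>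
     (\<forall>N. submodule N R M \<and> (\<forall>w\<in>carrier W. \<forall>x\<in>N. act w x \<in> N)
        \<longrightarrow> N = {\<zero>\<^bsub>M\<^esub>} \<or> N = carrier M)"

definition isomorphic_modules ::
  "('w, 'c) monoid_scheme \<Rightarrow> ('r, 'd) ring_scheme \<Rightarrow>
     ('r, 'm, 'e) module_scheme \<Rightarrow> ('w \<Rightarrow> 'm \<Rightarrow> 'm) \<Rightarrow>
     ('r, 'n, 'g) module_scheme \<Rightarrow> ('w \<Rightarrow> 'n \<Rightarrow> 'n) \<Rightarrow> bool" where
  "isomorphic_modules W R M act M' act' \<longleftrightarrow>
     (\<exists>\<phi>\<in>Group.iso (add_monoid M) (add_monoid M').
        (\<forall>c\<in>carrier R. \<forall>x\<in>carrier M. \<phi> (c \<odot>\<^bsub>M\<^esub> x) = c \<odot>\<^bsub>M'\<^esub> \<phi> x) \<and>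
        (\<forall>w\<in>carrier W. \<forall>x\<in>carrier M. \<phi> (act w x) = act' w (\<phi> x)))"

definition submodule_generated ::
  "('r, 'd) ring_scheme \<Rightarrow> ('r, 'm, 'e) module_scheme \<Rightarrow> 'm set \<Rightarrow> 'm set" where
  "submodule_generated R M S = \<Inter>{N. submodule N R M \<and> S \<subseteq> N}"

text \<open>
  The library's module record extends the ring record; the multiplicative fields play no role
  for modules and are left \<open>undefined\<close> below.
\<close>

definition quotient_module ::
  "('r, 'm, 'e) module_scheme \<Rightarrow> 'm set \<Rightarrow> ('r, 'm set) module" where
  "quotient_module M N =
     \<lparr>carrier = a_rcosets\<^bsub>M\<^esub> N, monoid.mult = undefined, one = undefined,
      ring.zero = N, add = set_add M,
      module.smult = (\<lambda>c A. \<Union>a\<in>A. N +>\<^bsub>M\<^esub> (c \<odot>\<^bsub>M\<^esub> a))\<rparr>"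

definition quotient_action ::
  "('r, 'm, 'e) module_scheme \<Rightarrow> 'm set \<Rightarrow> ('w \<Rightarrow> 'm \<Rightarrow> 'm) \<Rightarrow> 'w \<Rightarrow> 'm set \<Rightarrow> 'm set" where
  "quotient_action M N act w A = (\<Union>a\<in>A. N +>\<^bsub>M\<^esub> act w a)"

definition module_of_vector_space ::
  "('f::field \<Rightarrow> 'v::ab_group_add \<Rightarrow> 'v) \<Rightarrow> ('f, 'v) module" where
  "module_of_vector_space scale =
     \<lparr>carrier = UNIV, monoid.mult = undefined, one = undefined,
      ring.zero = 0, add = (+), module.smult = scale\<rparr>"

section \<open>Exterior powers\<close>

text \<open>
  The \<open>d\<close>-th exterior power of \<open>V\<close> is the free vector space on the \<open>d\<close>-tuples of vectors
  (lists of length \<open>d\<close>), modulo the relations that make \<open>(v\<^sub>1, \<dots>, v\<^sub>d) \<mapsto> v\<^sub>1 \<and> \<dots> \<and> v\<^sub>d\<close> multilinear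
  and alternating. For \<open>d = 0\<close> the only tuple is the empty one and there are no relations, so
  this is the field itself, with trivial action.
\<close>

definition free_module :: "'b set \<Rightarrow> ('f::field, 'b \<Rightarrow>\<^sub>0 'f) module" where
  "free_module I =
     \<lparr>carrier = {p. Poly_Mapping.keys p \<subseteq> I}, monoid.mult = undefined, one = undefined,
      ring.zero = 0, add = (+), module.smult = (\<lambda>c. Poly_Mapping.map ((*) c))\<rparr>"

definition free_action :: "('w \<Rightarrow> 'v \<Rightarrow> 'v) \<Rightarrow> 'w \<Rightarrow> ('v list \<Rightarrow>\<^sub>0 'f::field) \<Rightarrow> ('v list \<Rightarrow>\<^sub>0 'f)" where
  "free_action \<rho> w p =
     (\<Sum>vs\<in>Poly_Mapping.keys p. Poly_Mapping.single (map (\<rho> w) vs) (Poly_Mapping.lookup p vs))"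

abbreviation tuples :: "nat \<Rightarrow> 'v list set" where
  "tuples d \<equiv> {vs. length vs = d}"

inductive_set wedge_relators ::
  "('f::field \<Rightarrow> 'v::ab_group_add \<Rightarrow> 'v) \<Rightarrow> nat \<Rightarrow> ('v list \<Rightarrow>\<^sub>0 'f) set"
  for scale :: "'f \<Rightarrow> 'v \<Rightarrow> 'v" and d :: nat where
  additive: "length (us @ x # vs) = d \<Longrightarrow>
     Poly_Mapping.single (us @ (x + y) # vs) 1
       - (Poly_Mapping.single (us @ x # vs) 1 + Poly_Mapping.single (us @ y # vs) 1)
     \<in> wedge_relators scale d"
| homogeneous: "length (us @ x # vs) = d \<Longrightarrow>
     Poly_Mapping.single (us @ scale c x # vs) 1 - Poly_Mapping.single (us @ x # vs) c
     \<in> wedge_relators scale d"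
| alternating: "length vs = d \<Longrightarrow> \<not> distinct vs \<Longrightarrow>
     Poly_Mapping.single vs 1 \<in> wedge_relators scale d"

definition wedge_relations ::
  "('f::field \<Rightarrow> 'v::ab_group_add \<Rightarrow> 'v) \<Rightarrow> nat \<Rightarrow> ('v list \<Rightarrow>\<^sub>0 'f) set" where
  "wedge_relations scale d =
     submodule_generated ring_of_type_algebra (free_module (tuples d)) (wedge_relators scale d)"

definition exterior_power ::
  "('f::field \<Rightarrow> 'v::ab_group_add \<Rightarrow> 'v) \<Rightarrow> nat \<Rightarrow> ('f, ('v list \<Rightarrow>\<^sub>0 'f) set) module" where
  "exterior_power scale d = quotient_module (free_module (tuples d)) (wedge_relations scale d)"

definition exterior_action ::
  "('f::field \<Rightarrow> 'v::ab_group_add \<Rightarrow> 'v) \<Rightarrow> ('w \<Rightarrow> 'v \<Rightarrow> 'v) \<Rightarrow> nat \<Rightarrow>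
     'w \<Rightarrow> ('v list \<Rightarrow>\<^sub>0 'f) set \<Rightarrow> ('v list \<Rightarrow>\<^sub>0 'f) set" where
  "exterior_action scale \<rho> d =
     quotient_action (free_module (tuples d)) (wedge_relations scale d) (free_action \<rho>)"

end

theory Submission
  imports Defs "HOL-Combinatorics.Permutations"
begin

text \<open>
  The proof replaces the group \<open>W\<close> by a Lie algebra. Every endomorphism \<open>A\<close> of \<open>V\<close> acts on the
  exterior powers as the derivation \<open>D\<^sub>A\<close>, with
  \<open>D\<^sub>A (v\<^sub>1 \<and> \<dots> \<and> v\<^sub>d) = \<Sum>\<^sub>i v\<^sub>1 \<and> \<dots> \<and> A v\<^sub>i \<and> \<dots> \<and> v\<^sub>d\<close>. A reflection \<open>s\<close> is the identity plus an operator of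
  rank one, and a wedge product with two proportional factors vanishes; hence \<open>s\<close> acts on the
  exterior power exactly as \<open>1 + D\<^bsub>s - 1\<^esub>\<close> (\<open>pure_transvection\<close>).

  Write \<open>s\<^sub>i v = v + f\<^sub>i(v) \<alpha>\<^sub>i\<close>. The operators \<open>A\<close> for which \<open>D\<^sub>A\<close> preserves a given \<open>W\<close>-stable subspace form
  a Lie algebra, and it contains all \<open>s\<^sub>i - 1\<close>. The crucial fact is that the \<open>s\<^sub>i - 1\<close> generate the whole
  Lie algebra of endomorphisms of \<open>V\<close> (\<open>reflection_lie_algebra_eq_gl\<close>). With \<open>E\<^sub>i\<^sub>j v = f\<^sub>j(v) \<alpha>\<^sub>i\<close>, the
  brackets of \<open>E\<^sub>i\<^sub>i\<close> and \<open>E\<^sub>j\<^sub>j\<close> yield \<open>2 E\<^sub>i\<^sub>j\<close> up to a nonzero factor as soon as \<open>f\<^sub>i(\<alpha>\<^sub>j)\<close> is nonzero; symmetry of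
  the relation \<open>f\<^sub>i(\<alpha>\<^sub>j) \<noteq> 0\<close> and irreducibility of \<open>V\<close> make the graph of this relation connected, which
  gives all \<open>E\<^sub>i\<^sub>j\<close>; and irreducibility shows that the \<open>\<alpha>\<^sub>i\<close> span \<open>V\<close> and the \<open>f\<^sub>i\<close> span its dual.
  Therefore every \<open>W\<close>-stable subspace is stable under all derivations (\<open>derivation_stable\<close>).

  Both claims follow. A submodule of the exterior power is stable under all matrix units, and
  these move any nonzero element to every basis vector (\<open>gl_submodule_trivial\<close>); the exterior powers of degree at
  most \<open>n\<close> are nonzero because of determinants (\<open>basis_tuple_not_relation\<close>). An isomorphism between the
  powers of degrees \<open>d\<close> and \<open>e\<close> has a \<open>W\<close>-stable graph, so it commutes with \<open>D\<^sub>A\<close> for the identity \<open>A\<close>, which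
  is multiplication by \<open>d\<close> on one side and by \<open>e\<close> on the other; in characteristic \<open>0\<close> this forces
  \<open>d = e\<close>.

  Everything is carried out in the free vector space on lists of vectors, with subspaces that
  contain the wedge relations standing for subspaces of the exterior powers.
\<close>

section \<open>Free vector spaces and linear extension\<close>

definition fscale :: "'a::field \<Rightarrow> ('x \<Rightarrow>\<^sub>0 'a) \<Rightarrow> ('x \<Rightarrow>\<^sub>0 'a)" where
  "fscale c = Poly_Mapping.map ((*) c)"

lemma lookup_fscale [simp]: "Poly_Mapping.lookup (fscale c p) x = c * Poly_Mapping.lookup p x"
  by (simp add: fscale_def Poly_Mapping.map.rep_eq when_def)

interpretation F: vector_space fscale
  by unfold_locales (auto intro!: poly_mapping_eqI simp: lookup_add algebra_simps)

lemma fscale_single [simp]: "fscale c (Poly_Mapping.single x a) = Poly_Mapping.single x (c * a)"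
  by (intro poly_mapping_eqI) (simp add: lookup_single when_def)

lemma keys_fscale: "Poly_Mapping.keys (fscale c p) \<subseteq> Poly_Mapping.keys p"
  by (auto simp: in_keys_iff)

abbreviation supported :: "'x set \<Rightarrow> ('x \<Rightarrow>\<^sub>0 'a::zero) set" where
  "supported I \<equiv> {p. Poly_Mapping.keys p \<subseteq> I}"

lemma subspace_supported: "F.subspace (supported I :: ('x \<Rightarrow>\<^sub>0 'a::field) set)"
proof (rule F.subspaceI)
  show "p + q \<in> supported I" if "p \<in> supported I" "q \<in> supported I" for p q :: "'x \<Rightarrow>\<^sub>0 'a"
    using that keys_add[of p q] by blast
  show "fscale c p \<in> supported I" if "p \<in> supported I" for c and p :: "'x \<Rightarrow>\<^sub>0 'a"
    using that keys_fscale[of c p] by blast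
qed simp

definition lin_ext :: "('x \<Rightarrow> ('y \<Rightarrow>\<^sub>0 'a::field)) \<Rightarrow> ('x \<Rightarrow>\<^sub>0 'a) \<Rightarrow> ('y \<Rightarrow>\<^sub>0 'a)" where
  "lin_ext h p = (\<Sum>x\<in>Poly_Mapping.keys p. fscale (Poly_Mapping.lookup p x) (h x))"

text \<open>Summing over any finite set that contains the support makes linearity evident.\<close>
lemma lin_ext_superset:
  assumes "finite K" "Poly_Mapping.keys p \<subseteq> K"
  shows "lin_ext h p = (\<Sum>x\<in>K. fscale (Poly_Mapping.lookup p x) (h x))"
  unfolding lin_ext_def using assms
  by (intro sum.mono_neutral_left) (auto simp: in_keys_iff)

lemma lin_ext_add: "lin_ext h (p + q) = lin_ext h p + lin_ext h q"
proof -
  let ?K = "Poly_Mapping.keys p \<union> Poly_Mapping.keys q"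
  have "Poly_Mapping.keys (p + q) \<subseteq> ?K"
    by (rule keys_add)
  then show ?thesis
    by (simp add: lin_ext_superset[of ?K] lookup_add F.scale_left_distrib sum.distrib)
qed

lemma lin_ext_scale: "lin_ext h (fscale c p) = fscale c (lin_ext h p)"
  using keys_fscale[of c p]
  by (simp add: lin_ext_superset[of "Poly_Mapping.keys p"] F.scale_sum_right)

lemma lin_ext_single [simp]: "lin_ext h (Poly_Mapping.single x c) = fscale c (h x)"
  by (simp add: lin_ext_def)

lemma lin_ext_zero [simp]: "lin_ext h 0 = 0"
  by (simp add: lin_ext_def)

lemma lin_ext_diff: "lin_ext h (p - q) = lin_ext h p - lin_ext h q"
  using lin_ext_add[of h "p - q" q] by simp

lemma lin_ext_sum: "lin_ext h (sum g A) = (\<Sum>a\<in>A. lin_ext h (g a))"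
  by (induction A rule: infinite_finite_induct) (simp_all add: lin_ext_add)

lemma lin_ext_add_fun: "lin_ext (\<lambda>x. h x + h' x) p = lin_ext h p + lin_ext h' p"
  by (simp add: lin_ext_def F.scale_right_distrib sum.distrib)

lemma lin_ext_diff_fun: "lin_ext (\<lambda>x. h x - h' x) p = lin_ext h p - lin_ext h' p"
  by (simp add: lin_ext_def F.scale_right_diff_distrib sum_subtractf)

lemma lin_ext_scale_fun: "lin_ext (\<lambda>x. fscale c (h x)) p = fscale c (lin_ext h p)"
  by (simp add: lin_ext_def F.scale_sum_right mult.commute)

lemma lin_ext_mem:
  assumes "F.subspace M" "\<And>x. x \<in> Poly_Mapping.keys p \<Longrightarrow> h x \<in> M"
  shows "lin_ext h p \<in> M"
  unfolding lin_ext_def using assms by (intro F.subspace_sum F.subspace_scale)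

text \<open>The generator at \<open>x\<close>; at a tuple it represents the wedge product of the entries.\<close>
abbreviation pure :: "'x \<Rightarrow> 'x \<Rightarrow>\<^sub>0 'a::field" where
  "pure x \<equiv> Poly_Mapping.single x 1"

lemma lin_ext_pure: "lin_ext pure p = p"
  by (intro poly_mapping_eqI)
     (auto simp: lin_ext_def lookup_sum lookup_single when_def in_keys_iff if_distrib cong: if_cong)

lemma lin_ext_comp: "lin_ext g (lin_ext h p) = lin_ext (\<lambda>x. lin_ext g (h x)) p"
  by (simp add: lin_ext_def[of h] lin_ext_sum lin_ext_scale) (simp add: lin_ext_def)

lemma free_action_eq: "free_action \<rho> w = lin_ext (\<lambda>vs. pure (map (\<rho> w) vs))"
  by (simp add: fun_eq_iff free_action_def lin_ext_def)

section \<open>The Lie algebra generated by a reflection representation\<close>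

context finite_dimensional_vector_space
begin

text \<open>
  Induction in the manner of Gram and Schmidt: subtracting from a new vector its components along
  the earlier ones leaves a nonzero \<open>y\<close>, and a functional that does not vanish on \<open>y\<close> is corrected
  to vanish on the earlier vectors. For a basis \<open>S\<close> it follows that \<open>G\<close> is the whole dual space.
\<close>
lemma dual_family_exists:
  assumes lin: "\<And>g. g \<in> G \<Longrightarrow> Vector_Spaces.linear scale (*) g"
    and G_add: "\<And>g h. g \<in> G \<Longrightarrow> h \<in> G \<Longrightarrow> (\<lambda>v. g v + h v) \<in> G"
    and G_scale: "\<And>c g. g \<in> G \<Longrightarrow> (\<lambda>v. c * g v) \<in> G"
    and sep: "\<And>v. v \<noteq> 0 \<Longrightarrow> \<exists>g\<in>G. g v \<noteq> 0"
    and ne: "G \<noteq> {}"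
    and S: "finite S" "independent S"
  shows "\<exists>\<phi>. \<forall>b\<in>S. \<phi> b \<in> G \<and> (\<forall>c\<in>S. \<phi> b c = (if b = c then 1 else 0))"
  using S
proof (induction S rule: finite_induct)
  case empty
  then show ?case by simp
next
  case (insert x S)
  have zeroG: "(\<lambda>v. 0) \<in> G"
    using ne G_scale[where c = 0] by auto
  have sumG: "(\<lambda>v. \<Sum>b\<in>T. u b v) \<in> G" if "finite T" "\<And>b. b \<in> T \<Longrightarrow> u b \<in> G" for T :: "'b set" and u
    using that by (induction T rule: finite_induct) (auto simp: zeroG G_add)
  have "independent S"
    using insert.prems independent_mono by blast
  then obtain \<phi> where \<phi>G: "\<And>b. b \<in> S \<Longrightarrow> \<phi> b \<in> G"
    and \<phi>: "\<And>b c. b \<in> S \<Longrightarrow> c \<in> S \<Longrightarrow> \<phi> b c = (if b = c then 1 else 0)"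
    using insert.IH by metis
  define y where "y = x - (\<Sum>b\<in>S. \<phi> b x *s b)"
  have "x \<notin> span S"
    using insert.prems insert.hyps(2) by (simp add: independent_insert)
  moreover have "(\<Sum>b\<in>S. \<phi> b x *s b) \<in> span S"
    by (intro span_sum span_scale span_base)
  ultimately have "y \<noteq> 0"
    by (auto simp: y_def)
  then obtain g where g: "g \<in> G" "g y \<noteq> 0"
    using sep by blast
  interpret g: Vector_Spaces.linear scale "(*)" g
    using lin g(1) .
  have gy: "g y = g x - (\<Sum>b\<in>S. \<phi> b x * g b)"
    by (simp add: y_def g.diff g.sum g.scale)
  define h where "h v = g v - (\<Sum>b\<in>S. g b * \<phi> b v)" for v
  have "(\<lambda>v. g v + (-1) * (\<Sum>b\<in>S. g b * \<phi> b v)) \<in> G"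
    by (intro G_add g G_scale sumG insert.hyps \<phi>G)
  then have hG: "h \<in> G"
    by (simp add: h_def[abs_def])
  have hx: "h x \<noteq> 0"
    using g(2) by (simp add: h_def gy mult.commute)
  have hS: "h c = 0" if "c \<in> S" for c
  proof -
    have "(\<Sum>b\<in>S. g b * \<phi> b c) = (\<Sum>b\<in>S. if b = c then g b else 0)"
      by (intro sum.cong) (auto simp: \<phi> that)
    then show ?thesis
      using that insert.hyps(1) by (simp add: h_def)
  qed
  define \<psi> where "\<psi> b = (if b = x then (\<lambda>v. inverse (h x) * h v)
      else (\<lambda>v. \<phi> b v + (- \<phi> b x * inverse (h x)) * h v))" for b
  have "\<psi> b \<in> G" if "b \<in> insert x S" for b
    using that G_add[OF \<phi>G G_scale[OF hG]] G_scale[OF hG] unfolding \<psi>_def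
    by (cases "b = x") (simp_all only: if_True if_False insert_iff simp_thms)
  moreover have "\<psi> b c = (if b = c then 1 else 0)" if "b \<in> insert x S" "c \<in> insert x S" for b c
    using that hx insert.hyps(2) by (auto simp: \<psi>_def hS \<phi>)
  ultimately show ?case
    by blast
qed

text \<open>
  A Lie algebra \<open>L\<close> of endomorphisms that contains the rank-one operators \<open>E\<^sub>i\<^sub>i\<close> of an
  irreducible system is all of \<open>End V\<close>. All brackets are computed from
  \<open>E\<^sub>i\<^sub>j E\<^sub>k\<^sub>l = f\<^sub>j(\<alpha>\<^sub>k) E\<^sub>i\<^sub>l\<close>.
\<close>
theorem reflection_lie_algebra_eq_gl:
  fixes f :: "'i \<Rightarrow> 'b \<Rightarrow> 'a" and \<alpha> :: "'i \<Rightarrow> 'b" and L :: "('b \<Rightarrow> 'b) set"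
  assumes two: "(2::'a) \<noteq> 0"
    and L_add: "\<And>A B. A \<in> L \<Longrightarrow> B \<in> L \<Longrightarrow> (\<lambda>v. A v + B v) \<in> L"
    and L_scale: "\<And>c A. A \<in> L \<Longrightarrow> (\<lambda>v. c *s A v) \<in> L"
    and L_bracket: "\<And>A B. A \<in> L \<Longrightarrow> B \<in> L \<Longrightarrow> (\<lambda>v. A (B v) - B (A v)) \<in> L"
    and I: "I \<noteq> {}"
    and f: "\<And>i. i \<in> I \<Longrightarrow> Vector_Spaces.linear scale (*) (f i)"
    and refl: "\<And>i. i \<in> I \<Longrightarrow> (\<lambda>v. f i v *s \<alpha> i) \<in> L"
    and nondeg: "\<And>i. i \<in> I \<Longrightarrow> f i (\<alpha> i) \<noteq> 0"
    and sym: "\<And>i j. i \<in> I \<Longrightarrow> j \<in> I \<Longrightarrow> f i (\<alpha> j) = 0 \<longleftrightarrow> f j (\<alpha> i) = 0"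
    and irr: "\<And>U. subspace U \<Longrightarrow> (\<And>i v. i \<in> I \<Longrightarrow> v \<in> U \<Longrightarrow> f i v *s \<alpha> i \<in> U)
                \<Longrightarrow> U = {0} \<or> U = UNIV"
    and A: "Vector_Spaces.linear scale scale A"
  shows "A \<in> L"
proof -
  define E where "E i j = (\<lambda>v. f j v *s \<alpha> i)" for i j
  have fs: "f i (c *s v) = c * f i v" "f i (v + w) = f i v + f i w"
    "f i (v - w) = f i v - f i w" "f i 0 = 0" if "i \<in> I" for i c v w
  proof -
    interpret fi: Vector_Spaces.linear scale "(*)" "f i" using f that .
    show "f i (c *s v) = c * f i v" "f i (v + w) = f i v + f i w"
      "f i (v - w) = f i v - f i w" "f i 0 = 0"
      by (simp_all add: fi.scale fi.add fi.diff)
  qed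
  have a0: "\<alpha> i \<noteq> 0" if "i \<in> I" for i
    using nondeg[OF that] fs(4)[OF that] by metis
  have diag: "E i i \<in> L" if "i \<in> I" for i
    using refl[OF that] by (simp add: E_def)
  \<comment> \<open>With \<open>T = [E\<^sub>i\<^sub>i, E\<^sub>j\<^sub>j] = f\<^sub>i(\<alpha>\<^sub>j) E\<^sub>i\<^sub>j - f\<^sub>j(\<alpha>\<^sub>i) E\<^sub>j\<^sub>i\<close>, the bracket \<open>[E\<^sub>i\<^sub>i, T]\<close> contains the same two
      terms with equal signs, up to the factor \<open>f\<^sub>i(\<alpha>\<^sub>i)\<close> and a multiple of \<open>E\<^sub>i\<^sub>i\<close>. So \<open>E\<^sub>j\<^sub>i\<close>
      cancels and \<open>2 f\<^sub>i(\<alpha>\<^sub>i) f\<^sub>i(\<alpha>\<^sub>j) E\<^sub>i\<^sub>j\<close> remains.\<close>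
  have adj: "E i j \<in> L" if ij: "i \<in> I" "j \<in> I" and nz: "f i (\<alpha> j) \<noteq> 0" for i j
  proof -
    define T where "T = (\<lambda>v. E i i (E j j v) - E j j (E i i v))"
    have TL: "T \<in> L"
      unfolding T_def using ij by (intro L_bracket diag)
    define R where "R = (\<lambda>v. E i i (T v) - T (E i i v))"
    have RL: "R \<in> L"
      unfolding R_def using ij by (intro L_bracket diag TL)
    define Q where "Q = (\<lambda>v. (R v + f i (\<alpha> i) *s T v) + (2 * f i (\<alpha> j) * f j (\<alpha> i)) *s E i i v)"
    have QL: "Q \<in> L"
      unfolding Q_def using ij by (intro L_add L_scale diag TL RL)
    define d where "d = 2 * f i (\<alpha> i) * f i (\<alpha> j)"
    have "Q v = d *s E i j v" for v
      using ij by (simp add: d_def Q_def R_def T_def E_def fs algebra_simps flip: scale_left_distrib scale_minus_left)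
    moreover have "d \<noteq> 0"
      using two nz nondeg[OF ij(1)] by (simp add: d_def)
    ultimately have "(\<lambda>v. inverse d *s Q v) = E i j"
      by (simp add: fun_eq_iff)
    then show ?thesis
      using L_scale[OF QL] by metis
  qed
  \<comment> \<open>\<open>[E\<^sub>i\<^sub>j, E\<^sub>j\<^sub>l] = f\<^sub>j(\<alpha>\<^sub>j) E\<^sub>i\<^sub>l - f\<^sub>l(\<alpha>\<^sub>i) E\<^sub>j\<^sub>j\<close>\<close>
  have step: "E i l \<in> L" if ijl: "i \<in> I" "j \<in> I" "l \<in> I" and ij: "E i j \<in> L" and nz: "f j (\<alpha> l) \<noteq> 0" for i j l
  proof -
    define T where "T = (\<lambda>v. (E i j (E j l v) - E j l (E i j v)) + f l (\<alpha> i) *s E j j v)"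
    have "T \<in> L"
      unfolding T_def using ijl nz by (intro L_add L_scale L_bracket diag ij adj)
    moreover have "(\<lambda>v. inverse (f j (\<alpha> j)) *s T v) = E i l"
      using ijl nondeg[of j] by (auto simp: fun_eq_iff T_def E_def fs mult.commute)
    ultimately show ?thesis
      using L_scale by metis
  qed
  \<comment> \<open>The \<open>\<alpha>\<^sub>j\<close> with \<open>E\<^sub>i\<^sub>j\<close> in \<open>L\<close> span a stable subspace: by \<open>step\<close> and symmetry, the functionals of
      the other indices vanish on it. So it is \<open>V\<close>, and no other index can exist.\<close>
  have all: "E i m \<in> L" if i: "i \<in> I" and m: "m \<in> I" for i m
  proof (rule ccontr)
    assume notin: "E i m \<notin> L"
    define U where "U = span {\<alpha> j |j. j \<in> I \<and> E i j \<in> L}"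
    have inU: "\<alpha> j \<in> U" if "j \<in> I" "E i j \<in> L" for j
      unfolding U_def using that by (intro span_base) auto
    have vanish: "f l v = 0" if l: "l \<in> I" "E i l \<notin> L" and v: "v \<in> U" for l v
      using v unfolding U_def
    proof (induction rule: span_induct)
      case base
      show ?case
        using fs l by (auto intro!: subspaceI)
    next
      case (step x)
      then obtain j where j: "j \<in> I" "E i j \<in> L" "x = \<alpha> j" by auto
      have "f j (\<alpha> l) = 0"
        using \<open>\<And>l j i. i \<in> I \<Longrightarrow> j \<in> I \<Longrightarrow> l \<in> I \<Longrightarrow> E i j \<in> L \<Longrightarrow> f j (\<alpha> l) \<noteq> 0 \<Longrightarrow> E i l \<in> L\<close> i j l by blast
      then show ?case
        using sym[of j l] j l by simp
    qed
    have sub: "subspace U"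
      by (simp add: U_def)
    have "f l v *s \<alpha> l \<in> U" if l: "l \<in> I" and v: "v \<in> U" for l v
    proof (cases "E i l \<in> L")
      case True
      then show ?thesis using inU l sub by (intro subspace_scale)
    next
      case False
      then show ?thesis using vanish[OF l False v] sub by (simp add: subspace_0)
    qed
    from irr[OF sub this] have "U = {0} \<or> U = UNIV" .
    moreover have "\<alpha> i \<in> U"
      using inU i diag by blast
    ultimately have "U = UNIV"
      using a0[OF i] by auto
    then show False
      using vanish[OF m notin, of "\<alpha> m"] nondeg[OF m] by simp
  qed
  \<comment> \<open>From here on, the vectors \<open>\<alpha>\<^sub>i\<close> and then the functionals \<open>f\<^sub>j\<close> are replaced by
      arbitrary ones.\<close>
  have vec: "(\<lambda>v. f j v *s x) \<in> L" if j: "j \<in> I" for x j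
  proof -
    define U where "U = {x. (\<lambda>v. f j v *s x) \<in> L}"
    have aU: "\<alpha> i \<in> U" if "i \<in> I" for i
      using all[OF that j] by (simp add: U_def E_def)
    have "subspace U"
    proof (rule subspaceI)
      show "0 \<in> U"
        using L_scale[OF diag[OF j], of 0] by (simp add: U_def)
      show "x + y \<in> U" if "x \<in> U" "y \<in> U" for x y
        using L_add[of "\<lambda>v. f j v *s x" "\<lambda>v. f j v *s y"] that
        by (simp add: U_def scale_right_distrib)
      show "c *s x \<in> U" if "x \<in> U" for c x
        using L_scale[of "\<lambda>v. f j v *s x" c] that
        by (simp add: U_def mult.commute)
    qed
    moreover from this have "f i v *s \<alpha> i \<in> U" if "i \<in> I" "v \<in> U" for i v
      using that by (intro subspace_scale aU)
    ultimately have "U = {0} \<or> U = UNIV"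
      by (rule irr)
    then have "x \<in> U"
      using aU[OF j] a0[OF j] by auto
    then show ?thesis by (simp add: U_def)
  qed
  define G where "G = {g. Vector_Spaces.linear scale (*) g \<and> (\<forall>x. (\<lambda>v. g v *s x) \<in> L)}"
  have fG: "f j \<in> G" if "j \<in> I" for j
    using that f vec by (simp add: G_def)
  have addG: "(\<lambda>v. g v + h v) \<in> G" if "g \<in> G" "h \<in> G" for g h
  proof -
    interpret g: Vector_Spaces.linear scale "(*)" g using that by (simp add: G_def)
    interpret h: Vector_Spaces.linear scale "(*)" h using that by (simp add: G_def)
    have "Vector_Spaces.linear scale (*) (\<lambda>v. g v + h v)"
      by unfold_locales (simp_all add: g.add h.add g.scale h.scale algebra_simps)
    moreover have "(\<lambda>v. (g v + h v) *s x) \<in> L" for x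
      using L_add[of "\<lambda>v. g v *s x" "\<lambda>v. h v *s x"] that
      by (simp add: G_def scale_left_distrib)
    ultimately show ?thesis by (simp add: G_def)
  qed
  have scaleG: "(\<lambda>v. c * g v) \<in> G" if "g \<in> G" for c g
  proof -
    interpret g: Vector_Spaces.linear scale "(*)" g using that by (simp add: G_def)
    have "Vector_Spaces.linear scale (*) (\<lambda>v. c * g v)"
      by unfold_locales (simp_all only: g.add g.scale distrib_left mult.left_commute)
    moreover have "(\<lambda>v. (c * g v) *s x) \<in> L" for x
      using L_scale[of "\<lambda>v. g v *s x" c] that by (simp add: G_def)
    ultimately show ?thesis by (simp add: G_def)
  qed
  have sepG: "\<exists>g\<in>G. g v \<noteq> 0" if "v \<noteq> 0" for v
  proof (rule ccontr)
    assume "\<not> (\<exists>g\<in>G. g v \<noteq> 0)"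
    then have fv: "f j v = 0" if "j \<in> I" for j
      using fG that by blast
    define U where "U = {v. \<forall>j\<in>I. f j v = 0}"
    have sub: "subspace U"
      by (rule subspaceI) (auto simp: U_def fs)
    have "U = {0} \<or> U = UNIV"
      by (rule irr[OF sub]) (auto simp: U_def fs)
    moreover have "v \<in> U" using fv by (simp add: U_def)
    ultimately have "U = UNIV" using \<open>v \<noteq> 0\<close> by auto
    then show False
      using I nondeg by (auto simp: U_def)
  qed
  have "\<exists>\<phi>. \<forall>b\<in>Basis. \<phi> b \<in> G \<and> (\<forall>c\<in>Basis. \<phi> b c = (if b = c then 1 else 0))"
  proof (rule dual_family_exists[where G = G])
    show "Vector_Spaces.linear scale (*) g" if "g \<in> G" for g
      using that by (simp add: G_def)
    show "G \<noteq> {}"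
      using fG I by blast
  qed (fact addG scaleG sepG finite_Basis independent_Basis)+
  then obtain \<phi> where \<phi>G: "\<And>b. b \<in> Basis \<Longrightarrow> \<phi> b \<in> G"
    and \<phi>: "\<And>b c. b \<in> Basis \<Longrightarrow> c \<in> Basis \<Longrightarrow> \<phi> b c = (if b = c then 1 else 0)"
    by blast
  define A' where "A' = (\<lambda>v. \<Sum>b\<in>Basis. \<phi> b v *s A b)"
  have zeroL: "(\<lambda>v. 0) \<in> L"
    using I L_scale[OF diag, of _ 0] by auto
  have "(\<lambda>v. \<Sum>b\<in>T. \<phi> b v *s A b) \<in> L" if "T \<subseteq> Basis" for T
    using finite_subset[OF that finite_Basis] that
  proof (induction T rule: finite_induct)
    case (insert b T)
    then have "(\<lambda>v. \<phi> b v *s A b) \<in> L"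
      using \<phi>G[of b] by (simp add: G_def)
    then show ?case
      using insert L_add[of "\<lambda>v. \<phi> b v *s A b"] by simp
  qed (simp add: zeroL)
  then have A'L: "A' \<in> L"
    by (simp add: A'_def)
  interpret A: Vector_Spaces.linear scale scale A by fact
  have "A' v = A v" for v
  proof -
    have "v \<in> span Basis" by (simp add: span_Basis)
    then show ?thesis
    proof (induction rule: span_induct)
      case base
      have lin: "\<phi> b (x + y) = \<phi> b x + \<phi> b y" "\<phi> b (c *s x) = c * \<phi> b x" if "b \<in> Basis" for b c x y
      proof -
        interpret b: Vector_Spaces.linear scale "(*)" "\<phi> b" using \<phi>G[OF that] by (simp add: G_def)
        show "\<phi> b (x + y) = \<phi> b x + \<phi> b y" "\<phi> b (c *s x) = c * \<phi> b x" by (simp_all add: b.add b.scale)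
      qed
      have "A' (x + y) = A' x + A' y" "A' (c *s x) = c *s A' x" for c x y
        by (simp_all add: A'_def lin scale_left_distrib sum.distrib scale_sum_right)
      moreover from this(2)[of 0 0] have "A' 0 = 0" by simp
      ultimately show ?case
        by (intro subspaceI) (auto simp: A.add A.scale)
    next
      case (step x)
      have "A' x = (\<Sum>b\<in>Basis. if b = x then A b else 0)"
        unfolding A'_def using step by (intro sum.cong) (auto simp: \<phi>)
      then show ?case using step finite_Basis by simp
    qed
  qed
  then have "A' = A" by (rule ext)
  then show ?thesis using A'L by simp
qed

end

section \<open>Derivations of the tensor algebra modulo the wedge relations\<close>

text \<open>
  This is the derivation of the tensor algebra that extends \<open>A\<close>, lifted to the free vector space
  on tuples. It is defined there without reference to the multilinear relations, so that it
  needs no argument for being well defined.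
\<close>
definition derivation :: "('v \<Rightarrow> 'v) \<Rightarrow> ('v list \<Rightarrow>\<^sub>0 'a) \<Rightarrow> ('v list \<Rightarrow>\<^sub>0 'a::field)" where
  "derivation A = lin_ext (\<lambda>vs. \<Sum>i<length vs. pure (vs[i := A (vs ! i)]))"

lemma derivation_pure: "derivation A (pure vs) = (\<Sum>i<length vs. pure (vs[i := A (vs ! i)]))"
  by (simp add: derivation_def)

lemma derivation_id:
  assumes "Poly_Mapping.keys p \<subseteq> tuples d"
  shows "derivation (\<lambda>v. v) p = fscale (of_nat d) p"
proof -
  have "derivation (\<lambda>v. v) p = (\<Sum>x\<in>Poly_Mapping.keys p. fscale (Poly_Mapping.lookup p x) (fscale (of_nat d) (pure x)))"
    unfolding derivation_def lin_ext_def using assms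
    by (intro sum.cong) (auto simp: F.sum_constant_scale)
  also have "\<dots> = fscale (of_nat d) (lin_ext pure p)"
    by (simp add: lin_ext_def F.scale_sum_right mult.commute)
  finally show ?thesis by (simp add: lin_ext_pure)
qed

text \<open>
  The terms in which \<open>A\<close> and \<open>B\<close> act at different positions agree in both compositions and
  cancel. What remains differs from \<open>D\<^bsub>AB - BA\<^esub>\<close> by multilinearity at a single position.
\<close>
lemma derivation_commutator_pure:
  "derivation A (derivation B (pure vs)) - derivation B (derivation A (pure vs)) =
     (\<Sum>i<length vs. pure (vs[i := A (B (vs ! i))]) - pure (vs[i := B (A (vs ! i))]))"
proof -
  let ?n = "length vs"
  have *: "derivation A (derivation B (pure vs)) =
      (\<Sum>i<?n. \<Sum>j\<in>{..<?n} - {i}. pure (vs[i := B (vs ! i), j := A (vs ! j)]))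
      + (\<Sum>i<?n. pure (vs[i := A (B (vs ! i))]))" for A B
  proof -
    have "derivation A (derivation B (pure vs)) =
      (\<Sum>i<?n. \<Sum>j<?n. pure (vs[i := B (vs ! i), j := A (vs[i := B (vs ! i)] ! j)]))"
      by (simp add: derivation_def lin_ext_sum)
    also have "\<dots> = (\<Sum>i<?n. pure (vs[i := A (B (vs ! i))]) +
        (\<Sum>j\<in>{..<?n} - {i}. pure (vs[i := B (vs ! i), j := A (vs ! j)])))"
    proof (rule sum.cong)
      fix i assume "i \<in> {..<?n}"
      then show "(\<Sum>j<?n. pure (vs[i := B (vs ! i), j := A (vs[i := B (vs ! i)] ! j)])) =
          pure (vs[i := A (B (vs ! i))]) +
          (\<Sum>j\<in>{..<?n} - {i}. pure (vs[i := B (vs ! i), j := A (vs ! j)]))"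
        by (subst sum.remove[of _ i]) (simp_all cong: sum.cong_simp)
    qed simp
    finally show ?thesis by (simp add: sum.distrib add.commute)
  qed
  have "(\<Sum>i<?n. \<Sum>j\<in>{..<?n} - {i}. pure (vs[i := B (vs ! i), j := A (vs ! j)])) =
        (\<Sum>i<?n. \<Sum>j\<in>{..<?n} - {i}. pure (vs[i := A (vs ! i), j := B (vs ! j)]))"
  proof -
    have minus: "{..<?n} - {i} = {j \<in> {..<?n}. i \<noteq> j}" for i
      by auto
    have "(\<Sum>i<?n. \<Sum>j\<in>{..<?n} - {i}. pure (vs[i := B (vs ! i), j := A (vs ! j)])) =
          (\<Sum>j<?n. \<Sum>i\<in>{i \<in> {..<?n}. i \<noteq> j}. pure (vs[i := B (vs ! i), j := A (vs ! j)]))"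
      unfolding minus by (rule sum.swap_restrict) auto
    also have "\<dots> = (\<Sum>j<?n. \<Sum>i\<in>{..<?n} - {j}. pure (vs[j := A (vs ! j), i := B (vs ! i)]))"
      by (intro sum.cong) (auto simp: list_update_swap)
    finally show ?thesis .
  qed
  then show ?thesis
    unfolding *[of A B] *[of B A] by (simp add: sum_subtractf)
qed

lemma (in Modules.module) subspace_diff_trans:
  assumes "subspace M" "x - y \<in> M" "y - z \<in> M"
  shows "x - z \<in> M"
  using subspace_add[OF assms] by simp

abbreviation relations :: "('f::field \<Rightarrow> 'v::ab_group_add \<Rightarrow> 'v) \<Rightarrow> nat \<Rightarrow> ('v list \<Rightarrow>\<^sub>0 'f) set" where
  "relations scale d \<equiv> F.span (wedge_relators scale d)"

text \<open>
  The relations are restated for a list with one entry updated, the form in which derivations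
  produce them.
\<close>
lemma relations_add:
  assumes "length vs = d" "i < d"
  shows "pure (vs[i := x + y]) - (pure (vs[i := x]) + pure (vs[i := y])) \<in> relations scale d"
proof -
  have "vs[i := z] = take i vs @ z # drop (Suc i) vs" for z
    using assms by (simp add: upd_conv_take_nth_drop)
  moreover have "length (take i vs @ x # drop (Suc i) vs) = d"
    using assms by simp
  ultimately show ?thesis
    by (simp only: F.span_base[OF wedge_relators.additive])
qed

lemma relations_scale:
  assumes "length vs = d" "i < d"
  shows "pure (vs[i := scale c x]) - fscale c (pure (vs[i := x])) \<in> relations scale d"
proof -
  have "vs[i := z] = take i vs @ z # drop (Suc i) vs" for z
    using assms by (simp add: upd_conv_take_nth_drop)
  moreover have "length (take i vs @ x # drop (Suc i) vs) = d"
    using assms by simp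
  ultimately show ?thesis
    by (simp only: F.span_base[OF wedge_relators.homogeneous] fscale_single mult_1_right)
qed

lemma relations_alternating:
  assumes "length vs = d" "i < d" "j < d" "i \<noteq> j" "vs ! i = vs ! j"
  shows "pure vs \<in> relations scale d"
  using assms by (intro F.span_base wedge_relators.alternating) (auto simp: distinct_conv_nth)

lemma wedge_relators_update_cases [consumes 1, case_names additive homogeneous alternating]:
  assumes "r \<in> wedge_relators scale d"
  obtains
    (additive) vs i x y where "length vs = d" "i < d"
      "r = pure (vs[i := x + y]) - (pure (vs[i := x]) + pure (vs[i := y]))"
  | (homogeneous) vs i c x where "length vs = d" "i < d"
      "r = pure (vs[i := scale c x]) - fscale c (pure (vs[i := x]))"
  | (alternating) vs i j where "length vs = d" "i < d" "j < d" "i \<noteq> j" "vs ! i = vs ! j"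
      "r = pure vs"
  using assms
proof (cases rule: wedge_relators.cases)
  case (additive us x vs y)
  then show ?thesis
    using that(1)[of "us @ x # vs" "length us" x y] by simp
next
  case (homogeneous us x vs c)
  then show ?thesis
    using that(2)[of "us @ x # vs" "length us" c x] by simp
next
  case (alternating vs)
  then show ?thesis
    using that(3)[of vs] by (auto simp: distinct_conv_nth)
qed

text \<open>
  The universal property of the exterior power, for maps that need to be multilinear and
  alternating only modulo a subspace.
\<close>
lemma lin_ext_relations:
  assumes M: "F.subspace M"
    and add: "\<And>vs i x y. length vs = d \<Longrightarrow> i < d \<Longrightarrow>
      h (vs[i := x + y]) - (h (vs[i := x]) + h (vs[i := y])) \<in> M"
    and hom: "\<And>vs i c x. length vs = d \<Longrightarrow> i < d \<Longrightarrow>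
      h (vs[i := scale c x]) - fscale c (h (vs[i := x])) \<in> M"
    and alt: "\<And>vs i j. length vs = d \<Longrightarrow> i < d \<Longrightarrow> j < d \<Longrightarrow> i \<noteq> j \<Longrightarrow> vs ! i = vs ! j \<Longrightarrow> h vs \<in> M"
    and p: "p \<in> relations scale d"
  shows "lin_ext h p \<in> M"
  using p
proof (induction rule: F.span_induct)
  case base
  show ?case
    by (intro F.subspaceI) (auto simp: lin_ext_add lin_ext_scale M F.subspace_0 F.subspace_add F.subspace_scale)
next
  case (step r)
  then show ?case
    by (cases rule: wedge_relators_update_cases) (auto simp: lin_ext_diff lin_ext_add lin_ext_scale add hom alt)
qed

lemma relations_subset_tuples: "relations scale d \<subseteq> supported (tuples d)"
proof (rule F.span_minimal[OF _ subspace_supported])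
  show "wedge_relators scale d \<subseteq> supported (tuples d)"
  proof
    fix r assume "r \<in> wedge_relators scale d"
    then show "r \<in> supported (tuples d)"
      by (cases rule: wedge_relators_update_cases)
        (auto simp: in_keys_iff lookup_minus lookup_add lookup_single when_def split: if_splits)
  qed
qed

lemma relations_diff:
  fixes scale :: "'f::field \<Rightarrow> 'v::ab_group_add \<Rightarrow> 'v"
  assumes "length vs = d" "i < d"
  shows "pure (vs[i := x - y]) - (pure (vs[i := x]) - pure (vs[i := y])) \<in> relations scale d"
  using F.subspace_neg[OF F.subspace_span relations_add[OF assms, of "x - y" y scale]]
  by (simp add: algebra_simps)

text \<open>Polarisation of the alternating relation at \<open>x + y\<close>.\<close>
lemma relations_swap:
  fixes scale :: "'f::field \<Rightarrow> 'v::ab_group_add \<Rightarrow> 'v"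
  assumes vs: "length vs = d" "i < d" "j < d" "i \<noteq> j"
  shows "pure (vs[i := x, j := y]) + pure (vs[i := y, j := x]) \<in> relations scale d"
proof -
  define a where "a x y = (pure (vs[i := x, j := y]) :: 'v list \<Rightarrow>\<^sub>0 'f)" for x y
  have diag: "a z z \<in> relations scale d" for z
    unfolding a_def using vs by (intro relations_alternating[of _ _ i j]) auto
  have right: "a z (x + y) - (a z x + a z y) \<in> relations scale d" for z
    unfolding a_def using vs by (intro relations_add) auto
  have left: "a (x + y) z - (a x z + a y z) \<in> relations scale d" for z
    unfolding a_def using vs by (simp add: list_update_swap[OF vs(4)] relations_add)
  have "a (x + y) (x + y) - (a (x + y) (x + y) - (a x (x + y) + a y (x + y)))
      - (a x (x + y) - (a x x + a x y)) - (a y (x + y) - (a y x + a y y)) - a x x - a y y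
    \<in> relations scale d"
    by (intro F.span_diff diag left right)
  then show ?thesis
    by (simp add: a_def algebra_simps)
qed

text \<open>
  In the multilinear expansion of \<open>(v\<^sub>1 + c\<^sub>1 a) \<and> \<dots> \<and> (v\<^sub>d + c\<^sub>d a)\<close> every term with two factors \<open>a\<close> vanishes, so
  only the constant and the linear terms survive. Formally the entries are changed one after
  the other: \<open>l m\<close> has its first \<open>m\<close> entries changed.
\<close>
lemma pure_transvection:
  fixes scale :: "'f::field \<Rightarrow> 'v::ab_group_add \<Rightarrow> 'v" and f :: "'v \<Rightarrow> 'f"
  assumes vs: "length vs = d"
  shows "pure (map (\<lambda>v. v + scale (f v) a) vs) - pure vs - derivation (\<lambda>v. scale (f v) a) (pure vs)
    \<in> relations scale d"
proof -
  let ?R = "relations scale d"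
  define l where "l m = map (\<lambda>i. if i < m then vs ! i + scale (f (vs ! i)) a else vs ! i) [0..<d]" for m
  have len [simp]: "length (l m) = d" for m
    by (simp add: l_def)
  have l_Suc: "l (Suc m) = (l m)[m := vs ! m + scale (f (vs ! m)) a]" if "m < d" for m
    using that by (intro nth_equalityI) (auto simp: l_def nth_list_update)
  have l_same: "(l m)[m := vs ! m] = l m" if "m < d" for m
    using that by (intro nth_equalityI) (auto simp: l_def nth_list_update)
  have l0: "l 0 = vs"
    using vs by (intro nth_equalityI) (auto simp: l_def)
  have ld: "l d = map (\<lambda>v. v + scale (f v) a) vs"
    using vs by (intro nth_equalityI) (auto simp: l_def)
  \<comment> \<open>Once \<open>a\<close> stands at position \<open>p\<close>, multiples of \<open>a\<close> added elsewhere are invisible.\<close>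
  have absorb: "pure ((l m)[p := a]) - pure (vs[p := a]) \<in> ?R" if "m \<le> p" "p < d" for m p
    using that(1)
  proof (induction m)
    case 0
    then show ?case by (simp add: l0 F.span_zero)
  next
    case (Suc m)
    then have m: "m < d" "m \<noteq> p" using that by auto
    let ?k = "(l m)[p := a]"
    have k1: "?k[m := vs ! m + scale (f (vs ! m)) a] = (l (Suc m))[p := a]"
      and k2: "?k[m := vs ! m] = ?k"
      using m by (simp_all add: l_Suc list_update_swap[of p m] l_same)
    have "pure (?k[m := vs ! m + scale (f (vs ! m)) a])
        - (pure (?k[m := vs ! m]) + pure (?k[m := scale (f (vs ! m)) a])) \<in> ?R"
      using m by (intro relations_add) auto
    moreover have "pure (?k[m := scale (f (vs ! m)) a]) - fscale (f (vs ! m)) (pure (?k[m := a])) \<in> ?R"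
      using m by (intro relations_scale) auto
    moreover have "fscale (f (vs ! m)) (pure (?k[m := a])) \<in> ?R"
      using m that by (intro F.span_scale relations_alternating[of _ _ p m]) auto
    ultimately have "(pure ((l (Suc m))[p := a]) - (pure ?k + pure (?k[m := scale (f (vs ! m)) a])))
       + (pure (?k[m := scale (f (vs ! m)) a]) - fscale (f (vs ! m)) (pure (?k[m := a])))
       + fscale (f (vs ! m)) (pure (?k[m := a])) \<in> ?R"
      unfolding k1 k2 by (intro F.span_add)
    then have "pure ((l (Suc m))[p := a]) - pure ?k \<in> ?R"
      by (simp add: algebra_simps)
    then show ?case
      by (rule F.subspace_diff_trans[OF F.subspace_span]) (use Suc.IH Suc.prems in simp)
  qed
  have "pure (l m) - pure vs - (\<Sum>i<m. pure (vs[i := scale (f (vs ! i)) a])) \<in> ?R" if "m \<le> d" for m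
    using that
  proof (induction m)
    case 0
    then show ?case by (simp add: l0 F.span_zero)
  next
    case (Suc m)
    let ?c = "f (vs ! m)"
    have m: "m < d" using Suc by simp
    have "pure ((l m)[m := vs ! m + scale ?c a]) - (pure ((l m)[m := vs ! m]) + pure ((l m)[m := scale ?c a])) \<in> ?R"
      using m by (intro relations_add) auto
    then have 1: "pure (l (Suc m)) - (pure (l m) + pure ((l m)[m := scale ?c a])) \<in> ?R"
      using m by (simp add: l_Suc l_same)
    have 2: "pure ((l m)[m := scale ?c a]) - fscale ?c (pure ((l m)[m := a])) \<in> ?R"
      using m by (intro relations_scale) auto
    have 3: "fscale ?c (pure ((l m)[m := a]) - pure (vs[m := a])) \<in> ?R"
      using absorb[of m m] m by (intro F.span_scale) auto
    have 4: "pure (vs[m := scale ?c a]) - fscale ?c (pure (vs[m := a])) \<in> ?R"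
      using m vs by (intro relations_scale) auto
    have 5: "pure (l m) - pure vs - (\<Sum>i<m. pure (vs[i := scale (f (vs ! i)) a])) \<in> ?R"
      using Suc by simp
    have "(pure (l (Suc m)) - (pure (l m) + pure ((l m)[m := scale ?c a])))
      + (pure ((l m)[m := scale ?c a]) - fscale ?c (pure ((l m)[m := a])))
      + fscale ?c (pure ((l m)[m := a]) - pure (vs[m := a]))
      + (pure (l m) - pure vs - (\<Sum>i<m. pure (vs[i := scale (f (vs ! i)) a])))
      - (pure (vs[m := scale ?c a]) - fscale ?c (pure (vs[m := a]))) \<in> ?R"
      by (intro F.span_add F.span_diff 1 2 3 4 5)
    then show ?case
      by (simp add: algebra_simps F.scale_right_diff_distrib del: fscale_single)
  qed
  from this[of d] show ?thesis
    using vs by (simp add: ld derivation_pure)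
qed

text \<open>
  Only the relations of the degrees that occur in \<open>N\<close> are required. This covers a single exterior
  power as well as the sum of two of them, where graphs of homomorphisms live.
\<close>
definition contains_relations where
  "contains_relations scale N \<longleftrightarrow> F.subspace N \<and>
     (\<forall>p\<in>N. \<forall>vs\<in>Poly_Mapping.keys p. wedge_relators scale (length vs) \<subseteq> N)"

lemma contains_relationsD:
  assumes "contains_relations scale N"
  shows "F.subspace N"
    and "p \<in> N \<Longrightarrow> vs \<in> Poly_Mapping.keys p \<Longrightarrow> relations scale (length vs) \<subseteq> N"
proof -
  show "F.subspace N"
    using assms by (simp add: contains_relations_def)
  show "relations scale (length vs) \<subseteq> N" if "p \<in> N" "vs \<in> Poly_Mapping.keys p"
    using assms that by (intro F.span_minimal) (auto simp: contains_relations_def)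
qed

lemma lin_ext_mem_relations:
  assumes N: "contains_relations scale N" and p: "p \<in> N"
    and h: "\<And>vs. vs \<in> Poly_Mapping.keys p \<Longrightarrow> h vs \<in> relations scale (length vs)"
  shows "lin_ext h p \<in> N"
  using contains_relationsD[OF N] p h by (intro lin_ext_mem) auto

lemma derivation_add_mem:
  assumes N: "contains_relations scale N" and p: "p \<in> N"
    and AB: "derivation A p \<in> N" "derivation B p \<in> N"
  shows "derivation (\<lambda>v. A v + B v) p \<in> N"
proof -
  have "lin_ext (\<lambda>vs. derivation (\<lambda>v. A v + B v) (pure vs) - (derivation A (pure vs) + derivation B (pure vs))) p \<in> N"
    using N p by (rule lin_ext_mem_relations)
      (auto simp: derivation_pure sum_subtractf[symmetric] sum.distrib[symmetric]
        intro!: F.span_sum relations_add)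
  then have "derivation (\<lambda>v. A v + B v) p - (derivation A p + derivation B p) \<in> N"
    by (simp add: lin_ext_diff_fun lin_ext_add_fun derivation_pure) (simp add: derivation_def)
  then show ?thesis
    using F.subspace_add[OF contains_relationsD(1)[OF N]
        _ F.subspace_add[OF contains_relationsD(1)[OF N] AB]] by fastforce
qed

lemma derivation_scale_mem:
  assumes N: "contains_relations scale N" and p: "p \<in> N"
    and A: "derivation A p \<in> N"
  shows "derivation (\<lambda>v. scale c (A v)) p \<in> N"
proof -
  have "lin_ext (\<lambda>vs. derivation (\<lambda>v. scale c (A v)) (pure vs) - fscale c (derivation A (pure vs))) p \<in> N"
    using N p by (rule lin_ext_mem_relations)
      (auto simp: derivation_pure sum_subtractf[symmetric] F.scale_sum_right simp del: fscale_single
        intro!: F.span_sum relations_scale)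
  then have "derivation (\<lambda>v. scale c (A v)) p - fscale c (derivation A p) \<in> N"
    by (simp add: lin_ext_diff_fun lin_ext_scale_fun derivation_pure del: fscale_single) (simp add: derivation_def)
  then show ?thesis
    using F.subspace_add[OF contains_relationsD(1)[OF N]
        _ F.subspace_scale[OF contains_relationsD(1)[OF N] A, of c]] by fastforce
qed

lemma derivation_derivation: "derivation A (derivation B p) = lin_ext (\<lambda>vs. derivation A (derivation B (pure vs))) p"
  unfolding derivation_pure[of B] by (simp add: derivation_def lin_ext_comp)

lemma derivation_bracket_mem:
  fixes scale :: "'f::field \<Rightarrow> 'v::ab_group_add \<Rightarrow> 'v"
  assumes N: "contains_relations scale N" and p: "p \<in> N"
    and AB: "derivation A (derivation B p) \<in> N" "derivation B (derivation A p) \<in> N"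
  shows "derivation (\<lambda>v. A (B v) - B (A v)) p \<in> N"
proof -
  have "lin_ext (\<lambda>vs. derivation (\<lambda>v. A (B v) - B (A v)) (pure vs)
      - (derivation A (derivation B (pure vs)) - derivation B (derivation A (pure vs)))) p \<in> N"
    using N p by (rule lin_ext_mem_relations)
      (auto simp: derivation_commutator_pure derivation_pure[of "\<lambda>v. A (B v) - B (A v)"] sum_subtractf[symmetric]
        intro!: F.span_sum relations_diff)
  then have "derivation (\<lambda>v. A (B v) - B (A v)) p
      - (derivation A (derivation B p) - derivation B (derivation A p)) \<in> N"
    unfolding lin_ext_diff_fun derivation_derivation[symmetric]
    by (simp add: derivation_pure) (simp add: derivation_def)
  then show ?thesis
    using F.subspace_add[OF contains_relationsD(1)[OF N]
        _ F.subspace_diff[OF contains_relationsD(1)[OF N] AB]] by fastforce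
qed

context finite_dimensional_vector_space
begin

text \<open>
  The operators whose derivation preserves \<open>N\<close> form a Lie algebra by the three closure lemmas, and
  \<open>pure_transvection\<close> puts the rank-one parts of the reflections into it.
\<close>
theorem derivation_stable:
  fixes f :: "'i \<Rightarrow> 'b \<Rightarrow> 'a" and \<alpha> :: "'i \<Rightarrow> 'b" and N :: "('b list \<Rightarrow>\<^sub>0 'a) set"
  assumes two: "(2::'a) \<noteq> 0"
    and I: "I \<noteq> {}"
    and f: "\<And>i. i \<in> I \<Longrightarrow> Vector_Spaces.linear scale (*) (f i)"
    and nondeg: "\<And>i. i \<in> I \<Longrightarrow> f i (\<alpha> i) \<noteq> 0"
    and sym: "\<And>i j. i \<in> I \<Longrightarrow> j \<in> I \<Longrightarrow> f i (\<alpha> j) = 0 \<longleftrightarrow> f j (\<alpha> i) = 0"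
    and irr: "\<And>U. subspace U \<Longrightarrow> (\<And>i v. i \<in> I \<Longrightarrow> v \<in> U \<Longrightarrow> f i v *s \<alpha> i \<in> U)
                \<Longrightarrow> U = {0} \<or> U = UNIV"
    and N: "contains_relations scale N"
    and stable: "\<And>i p. i \<in> I \<Longrightarrow> p \<in> N \<Longrightarrow> lin_ext (\<lambda>vs. pure (map (\<lambda>v. v + f i v *s \<alpha> i) vs)) p \<in> N"
    and A: "Vector_Spaces.linear scale scale A" and p: "p \<in> N"
  shows "derivation A p \<in> N"
proof -
  have "A \<in> {A. \<forall>p\<in>N. derivation A p \<in> N}"
  proof (rule reflection_lie_algebra_eq_gl[OF two _ _ _ I f _ nondeg sym irr A])
    fix i assume i: "i \<in> I"
    have "derivation (\<lambda>v. f i v *s \<alpha> i) p \<in> N" if p: "p \<in> N" for p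
    proof -
      let ?g = "lin_ext (\<lambda>vs. pure (map (\<lambda>v. v + f i v *s \<alpha> i) vs)) p"
      have "lin_ext (\<lambda>vs. pure (map (\<lambda>v. v + f i v *s \<alpha> i) vs) - pure vs
          - derivation (\<lambda>v. f i v *s \<alpha> i) (pure vs)) p \<in> N"
        using N p by (rule lin_ext_mem_relations) (intro pure_transvection refl)
      then have "?g - p - derivation (\<lambda>v. f i v *s \<alpha> i) p \<in> N"
        by (simp add: lin_ext_diff_fun lin_ext_pure derivation_pure) (simp add: derivation_def)
      from F.subspace_diff[OF contains_relationsD(1)[OF N] F.subspace_diff[OF contains_relationsD(1)[OF N] stable[OF i p] p] this]
      show ?thesis by simp
    qed
    then show "(\<lambda>v. f i v *s \<alpha> i) \<in> {A. \<forall>p\<in>N. derivation A p \<in> N}" by simp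
  qed (use N in \<open>auto intro: derivation_add_mem derivation_scale_mem derivation_bracket_mem\<close>)
  then show ?thesis using p by simp
qed

end

section \<open>Irreducibility of the exterior powers under the general linear Lie algebra\<close>

context finite_dimensional_vector_space
begin

text \<open>The matrix unit with respect to \<open>Basis\<close> that sends \<open>b\<close> to \<open>c\<close>.\<close>
definition elementary :: "'b \<Rightarrow> 'b \<Rightarrow> 'b \<Rightarrow> 'b" where
  "elementary b c = (\<lambda>v. representation Basis v b *s c)"

lemma linear_elementary: "Vector_Spaces.linear scale scale (elementary b c)"
  by unfold_locales
    (simp_all add: elementary_def representation_add representation_scale independent_Basis span_Basis
      scale_left_distrib)

lemma elementary_Basis:
  assumes "x \<in> Basis"
  shows "elementary b c x = (if x = b then c else 0)"
  using assms by (simp add: elementary_def representation_basis independent_Basis)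

lemma relations_zero_entry:
  assumes "length vs = d" "i < d"
  shows "pure (vs[i := 0]) \<in> relations scale d"
  using relations_scale[OF assms, of scale 0 0] by simp

text \<open>
  A matrix unit kills all entries of a tuple of distinct basis vectors but one, so its derivation
  replaces that entry. For \<open>c = us ! p\<close> the tuple is fixed: derivations of diagonal matrix units
  project onto the basis wedges that involve a given basis vector.
\<close>
lemma derivation_elementary_replace:
  assumes us: "distinct us" "set us \<subseteq> Basis" "length us = d" and p: "p < d"
  shows "derivation (elementary (us ! p) c) (pure us) - pure (us[p := c]) \<in> relations scale d"
proof -
  have "derivation (elementary (us ! p) c) (pure us) - pure (us[p := c]) =
      (\<Sum>i\<in>{..<d} - {p}. pure (us[i := elementary (us ! p) c (us ! i)]))"
    using us p by (simp add: derivation_pure sum.remove[of _ p] elementary_Basis subset_iff)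
  also have "\<dots> \<in> relations scale d"
  proof (rule F.span_sum)
    fix i assume i: "i \<in> {..<d} - {p}"
    have "us ! i \<noteq> us ! p" "us ! i \<in> Basis"
      using us p i by (auto simp: nth_eq_iff_index_eq)
    then have "elementary (us ! p) c (us ! i) = 0"
      by (simp add: elementary_Basis)
    then show "pure (us[i := elementary (us ! p) c (us ! i)]) \<in> relations scale d"
      using relations_zero_entry us i by simp
  qed
  finally show ?thesis .
qed

lemma derivation_elementary_outside:
  assumes us: "set us \<subseteq> Basis" "length us = d" and b: "b \<notin> set us"
  shows "derivation (elementary b c) (pure us) \<in> relations scale d"
  unfolding derivation_pure us(2)
proof (rule F.span_sum)
  fix i assume i: "i \<in> {..<d}"
  have "us ! i \<noteq> b" "us ! i \<in> Basis"
    using us b i by (auto simp: nth_mem)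
  then have "elementary b c (us ! i) = 0"
    by (simp add: elementary_Basis)
  then show "pure (us[i := elementary b c (us ! i)]) \<in> relations scale d"
    using relations_zero_entry us i by simp
qed

text \<open>
  Multilinearity reduces all tuples to tuples of basis vectors; the inner statement bounds the
  positions that may hold other vectors by \<open>m\<close>.
\<close>
lemma pure_mem_if_basis_tuples_mem:
  assumes M: "F.subspace M" "relations scale d \<subseteq> M"
    and basis: "\<And>us. length us = d \<Longrightarrow> set us \<subseteq> Basis \<Longrightarrow> pure us \<in> M"
    and vs: "length vs = d"
  shows "pure vs \<in> M"
proof -
  have "pure vs \<in> M" if "length vs = d" "\<And>i. m \<le> i \<Longrightarrow> i < d \<Longrightarrow> vs ! i \<in> Basis" for m vs
    using that
  proof (induction m arbitrary: vs)
    case 0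
    then have "set vs \<subseteq> Basis" by (auto simp: in_set_conv_nth)
    then show ?case using basis 0 by blast
  next
    case (Suc m)
    show ?case
    proof (cases "m < d")
      case False
      then show ?thesis using Suc by auto
    next
      case True
      have "vs ! m \<in> span Basis" by (simp add: span_Basis)
      then have "pure (vs[m := vs ! m]) \<in> M"
      proof (induction rule: span_induct)
        case base
        have add: "pure (vs[m := x + y]) \<in> M" if "pure (vs[m := x]) \<in> M" "pure (vs[m := y]) \<in> M" for x y
          using F.subspace_add[OF M(1) subsetD[OF M(2) relations_add[OF Suc.prems(1) True, of x y]]
              F.subspace_add[OF M(1) that]] by simp
        have hom: "pure (vs[m := c *s x]) \<in> M" if "pure (vs[m := x]) \<in> M" for c x
          using F.subspace_add[OF M(1) subsetD[OF M(2) relations_scale[OF Suc.prems(1) True, of scale c x]]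
              F.subspace_scale[OF M(1) that, of c]] by simp
        show ?case
          using relations_zero_entry[OF Suc.prems(1) True] M(2) add hom
          by (intro subspaceI) auto
      next
        case (step b)
        show ?case
          by (rule Suc.IH) (use Suc.prems step True in \<open>auto simp: nth_list_update\<close>)
      qed
      then show ?thesis by simp
    qed
  qed
  from this[of vs d] show ?thesis using vs by simp
qed

text \<open>
  Rearranging a tuple changes its wedge product at most by a sign. One swap brings the right
  head to the front, and the prefix \<open>pre\<close> collects the entries that are already in place.
\<close>
lemma pure_mem_permute:
  fixes M :: "('b list \<Rightarrow>\<^sub>0 'a) set"
  assumes M: "F.subspace M" "relations scale d \<subseteq> M"
  shows "mset us = mset ws \<Longrightarrow> length (pre @ us) = d \<Longrightarrow> pure (pre @ us) \<in> M \<Longrightarrow> pure (pre @ ws) \<in> M"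
proof (induction ws arbitrary: pre us)
  case Nil
  then show ?case by simp
next
  case (Cons w ws)
  obtain u us' where us: "us = u # us'"
    using Cons.prems(1) by (cases us) auto
  show ?case
  proof (cases "u = w")
    case True
    then show ?thesis
      using Cons.IH[of us' "pre @ [w]"] Cons.prems us by simp
  next
    case False
    then have "w \<in> set us'"
      using Cons.prems(1) us by (metis insert_iff list.set_intros(1) list.simps(15) set_mset_mset)
    then obtain a b where ab: "us' = a @ w # b"
      by (meson split_list)
    let ?vs = "pre @ u # a @ w # b"
    have "pure (?vs[length pre := u, length pre + Suc (length a) := w])
        + pure (?vs[length pre := w, length pre + Suc (length a) := u]) \<in> relations scale d"
      using Cons.prems(2) us ab by (intro relations_swap) auto
    then have "pure (pre @ us) + pure (pre @ w # a @ u # b) \<in> M"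
      using M(2) us ab by (auto simp: list_update_append)
    from F.subspace_diff[OF M(1) this Cons.prems(3)]
    have "pure ((pre @ [w]) @ (a @ u # b)) \<in> M" by simp
    then show ?thesis
      using Cons.IH[of "a @ u # b" "pre @ [w]"] Cons.prems us ab by simp
  qed
qed

lemma pure_mem_same_set:
  fixes M :: "('b list \<Rightarrow>\<^sub>0 'a) set"
  assumes "F.subspace M" "relations scale d \<subseteq> M" "distinct us" "distinct ws" "set us = set ws"
    "length us = d" "pure us \<in> M"
  shows "pure ws \<in> M"
  using pure_mem_permute[OF assms(1,2), of us ws "[]"] assms by (simp add: set_eq_iff_mset_eq_distinct)

text \<open>
  One tuple \<open>e J\<close> is fixed for each \<open>d\<close>-element set \<open>J\<close> of basis vectors. An element of \<open>N\<close> that is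
  not a relation is split by the projections \<open>D\<^bsub>E\<^sub>b\<^sub>b\<^esub>\<close> until a single \<open>e J\<close> is left in \<open>N\<close>;
  the other matrix units then exchange the elements of \<open>J\<close> one by one for those of any
  other set.
\<close>
theorem gl_submodule_trivial:
  fixes N :: "('b list \<Rightarrow>\<^sub>0 'a) set"
  assumes N: "F.subspace N" and RN: "relations scale d \<subseteq> N" and NF: "N \<subseteq> supported (tuples d)"
    and stable: "\<And>A p. Vector_Spaces.linear scale scale A \<Longrightarrow> p \<in> N \<Longrightarrow> derivation A p \<in> N"
  shows "N = relations scale d \<or> N = supported (tuples d)"
proof -
  let ?R = "relations scale d"
  have zero: "0 \<in> ?R"
    by (rule F.span_zero)
  define S where "S = {J. J \<subseteq> Basis \<and> card J = d}"
  have finS: "finite S"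
    by (rule finite_subset[of _ "Pow Basis"]) (auto simp: S_def finite_Basis)
  have finJ: "finite J" if "J \<in> S" for J
    using that by (intro finite_subset[OF _ finite_Basis]) (simp add: S_def)
  define e where "e J = (SOME us. distinct us \<and> set us = J)" for J :: "'b set"
  have e: "distinct (e J)" "set (e J) = J" "length (e J) = d" if "J \<in> S" for J
  proof -
    have "distinct (e J) \<and> set (e J) = J"
      unfolding e_def by (rule someI_ex) (use finite_distinct_list[OF finJ[OF that]] in blast)
    then show "distinct (e J)" "set (e J) = J" "length (e J) = d"
      using that distinct_card[of "e J"] by (auto simp: S_def)
  qed
  have subset_eq: "J = K" if "J \<in> S" "K \<in> S" "J \<subseteq> K" for J K
    by (rule card_subset_eq[OF finJ[OF that(2)] that(3)]) (use that in \<open>simp add: S_def\<close>)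
  have generate: "supported (tuples d) \<subseteq> M"
    if M: "F.subspace M" "?R \<subseteq> M" and eM: "\<And>J. J \<in> S \<Longrightarrow> pure (e J) \<in> M" for M
  proof
    fix p :: "'b list \<Rightarrow>\<^sub>0 'a" assume p: "p \<in> supported (tuples d)"
    have "pure us \<in> M" if us: "length us = d" "set us \<subseteq> Basis" for us
    proof (cases "distinct us")
      case True
      then have J: "set us \<in> S"
        using us distinct_card[of us] by (auto simp: S_def)
      show ?thesis
        by (rule pure_mem_same_set[OF M, of "e (set us)"]) (use e[OF J] eM[OF J] True in auto)
    next
      case False
      then show ?thesis
        using M(2) us by (intro subsetD[OF M(2)] F.span_base wedge_relators.alternating)
    qed
    then have "pure vs \<in> M" if "length vs = d" for vs
      using pure_mem_if_basis_tuples_mem[OF M] that by blast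
    then have "lin_ext pure p \<in> M"
      using p by (intro lin_ext_mem M) auto
    then show "p \<in> M" by (simp add: lin_ext_pure)
  qed
  have split: "\<exists>J\<in>T. pure (e J) \<in> N"
    if "T \<subseteq> S" "(\<Sum>J\<in>T. fscale (c J) (pure (e J))) \<in> N" "(\<Sum>J\<in>T. fscale (c J) (pure (e J))) \<notin> ?R" for T c
    using that
  proof (induction "card T" arbitrary: T rule: less_induct)
    case less
    let ?y = "\<lambda>T. \<Sum>J\<in>T. fscale (c J) (pure (e J))"
    have finT: "finite T" by (rule finite_subset[OF less.prems(1) finS])
    have "T \<noteq> {}" using less.prems(3) zero by auto
    then obtain J where J: "J \<in> T" by blast
    show ?case
    proof (cases "T = {J}")
      case True
      then have "c J \<noteq> 0" "fscale (c J) (pure (e J)) \<in> N"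
        using less.prems zero by auto
      then have "fscale (inverse (c J)) (fscale (c J) (pure (e J))) \<in> N"
        by (intro F.subspace_scale[OF N, of "fscale (c J) (pure (e J))"])
      then show ?thesis using \<open>c J \<noteq> 0\<close> J by auto
    next
      case False
      then obtain K where K: "K \<in> T" "K \<noteq> J" using J by blast
      have "\<not> J \<subseteq> K"
        using K J less.prems(1) subset_eq by blast
      \<comment> \<open>Both parts \<open>T1\<close> and \<open>T2\<close> are smaller than \<open>T\<close>, and they cannot both be relations.\<close>
      then obtain b where b: "b \<in> J" "b \<notin> K" by blast
      define T1 where "T1 = {J \<in> T. b \<in> J}"
      define T2 where "T2 = {J \<in> T. b \<notin> J}"
      have T12: "T = T1 \<union> T2" "T1 \<inter> T2 = {}" by (auto simp: T1_def T2_def)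
      have sub: "T1 \<subset> T" "T2 \<subset> T" using b J K by (auto simp: T1_def T2_def)
      have ysplit: "?y T = ?y T1 + ?y T2"
        unfolding T12(1) by (rule sum.union_disjoint) (use finT T12 in auto)
      have "derivation (elementary b b) (?y T) =
          (\<Sum>J\<in>T. fscale (c J) (derivation (elementary b b) (pure (e J))))"
        by (simp add: derivation_def lin_ext_sum lin_ext_scale del: fscale_single lin_ext_single)
      moreover have "?y T1 = (\<Sum>J\<in>T. fscale (c J) (if b \<in> J then pure (e J) else 0))"
        unfolding T1_def sum.inter_filter[OF finT] by (intro sum.cong) auto
      ultimately have "derivation (elementary b b) (?y T) - ?y T1 =
          (\<Sum>J\<in>T. fscale (c J) (derivation (elementary b b) (pure (e J)) - (if b \<in> J then pure (e J) else 0)))"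
        by (simp only: F.scale_right_diff_distrib sum_subtractf)
      also have "\<dots> \<in> ?R"
      proof (intro F.span_sum F.span_scale)
        fix J assume "J \<in> T"
        then have J: "J \<in> S" using less.prems by blast
        then have JB: "J \<subseteq> Basis" by (simp add: S_def)
        show "derivation (elementary b b) (pure (e J)) - (if b \<in> J then pure (e J) else 0) \<in> ?R"
        proof (cases "b \<in> J")
          case True
          then obtain p where p: "p < d" "e J ! p = b"
            using e[OF J] by (metis in_set_conv_nth)
          have "(e J)[p := b] = e J" using p by (metis list_update_id)
          then show ?thesis
            using derivation_elementary_replace[of "e J" d p b] e[OF J] JB p True by simp
        next
          case False
          then show ?thesis
            using derivation_elementary_outside[of "e J" d b b] e[OF J] JB by simp
        qed
      qed
      finally have "derivation (elementary b b) (?y T) - ?y T1 \<in> N" using RN by blast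
      from F.subspace_diff[OF N stable[OF linear_elementary[of b b] less.prems(2)] this]
      have y1: "?y T1 \<in> N" by simp
      from F.subspace_diff[OF N less.prems(2) this] have y2: "?y T2 \<in> N"
        by (simp only: ysplit add_diff_cancel_left')
      have "?y T1 \<notin> ?R \<or> ?y T2 \<notin> ?R"
        using less.prems(3) F.subspace_add[OF F.subspace_span, of "?y T1" "wedge_relators scale d" "?y T2"]
        unfolding ysplit by blast
      then show ?thesis
      proof
        assume "?y T1 \<notin> ?R"
        from less.hyps[OF psubset_card_mono[OF finT sub(1)] _ y1 this] show ?thesis
          using less.prems(1) sub by blast
      next
        assume "?y T2 \<notin> ?R"
        from less.hyps[OF psubset_card_mono[OF finT sub(2)] _ y2 this] show ?thesis
          using less.prems(1) sub by blast
      qed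
    qed
  qed
  have move: "pure (e K) \<in> N" if "J \<in> S" "K \<in> S" "pure (e J) \<in> N" for J K
    using that
  proof (induction "card (J - K)" arbitrary: J rule: less_induct)
    case less
    show ?case
    proof (cases "J \<subseteq> K")
      case True
      then have "J = K"
        using less.prems(1,2) by (intro subset_eq)
      then show ?thesis using less.prems by simp
    next
      case False
      then obtain b where b: "b \<in> J" "b \<notin> K" by blast
      have "\<not> K \<subseteq> J"
        using less.prems(1,2) subset_eq[of K J] b by blast
      then obtain c where c: "c \<in> K" "c \<notin> J" by blast
      define J' where "J' = insert c (J - {b})"
      have J': "J' \<in> S"
        using less.prems(1,2) finJ[OF less.prems(1)] b c
        by (auto simp: J'_def S_def card_insert_if card_Diff_singleton) (metis Suc_pred card_gt_0_iff empty_iff)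
      obtain p where p: "p < d" "e J ! p = b"
        using e[OF less.prems(1)] b by (metis in_set_conv_nth)
      have "derivation (elementary b c) (pure (e J)) - pure ((e J)[p := c]) \<in> ?R"
        using derivation_elementary_replace[of "e J" d p c] e[OF less.prems(1)] less.prems(1) p
        by (simp add: S_def)
      from F.subspace_diff[OF N stable[OF linear_elementary[of b c] less.prems(3)] subsetD[OF RN this]]
      have *: "pure ((e J)[p := c]) \<in> N" by simp
      have "pure (e J') \<in> N"
      proof (rule pure_mem_same_set[OF N RN _ _ _ _ *])
        show "distinct ((e J)[p := c])"
          using e[OF less.prems(1)] c by (simp add: distinct_list_update)
        show "set ((e J)[p := c]) = set (e J')"
          using e[OF less.prems(1)] e[OF J'] p by (simp add: set_update_distinct J'_def)
      qed (use e[OF less.prems(1)] e[OF J'] in auto)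
      moreover have "card (J' - K) < card (J - K)"
      proof (rule psubset_card_mono)
        show "J' - K \<subset> J - K" using b c by (auto simp: J'_def)
      qed (use finJ less.prems in auto)
      ultimately show ?thesis
        using less.hyps[of J'] J' less.prems by blast
    qed
  qed
  show ?thesis
  proof (cases "N \<subseteq> ?R")
    case True
    then show ?thesis using RN by blast
  next
    case False
    then obtain x where x: "x \<in> N" "x \<notin> ?R" by blast
    \<comment> \<open>Every element of degree \<open>d\<close> is a combination of the tuples \<open>e J\<close> modulo relations.\<close>
    define M where "M = {x. \<exists>c. x - (\<Sum>J\<in>S. fscale (c J) (pure (e J))) \<in> ?R}"
    have "supported (tuples d) \<subseteq> M"
    proof (rule generate)
      show "F.subspace M"
      proof (rule F.subspaceI)
        show "0 \<in> M"
          by (auto simp: M_def intro!: exI[of _ "\<lambda>_. 0"] F.span_zero)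
        show "x + y \<in> M" if xy: "x \<in> M" "y \<in> M" for x y
        proof -
          obtain c c' where
            "x - (\<Sum>J\<in>S. fscale (c J) (pure (e J))) \<in> ?R" "y - (\<Sum>J\<in>S. fscale (c' J) (pure (e J))) \<in> ?R"
            using xy by (auto simp: M_def)
          from F.span_add[OF this] have "x + y - (\<Sum>J\<in>S. fscale (c J + c' J) (pure (e J))) \<in> ?R"
            by (simp add: F.scale_left_distrib sum.distrib algebra_simps del: fscale_single)
          then show ?thesis by (auto simp: M_def)
        qed
        show "fscale a x \<in> M" if x: "x \<in> M" for a x
        proof -
          obtain c where "x - (\<Sum>J\<in>S. fscale (c J) (pure (e J))) \<in> ?R"
            using x by (auto simp: M_def)
          from F.span_scale[OF this, of a] have "fscale a x - (\<Sum>J\<in>S. fscale (a * c J) (pure (e J))) \<in> ?R"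
            by (simp add: F.scale_right_diff_distrib F.scale_sum_right del: fscale_single)
          then show ?thesis by (auto simp: M_def)
        qed
      qed
      show "?R \<subseteq> M"
        by (auto simp: M_def intro!: exI[of _ "\<lambda>_. 0"])
      show "pure (e J) \<in> M" if "J \<in> S" for J
      proof -
        have "(\<Sum>K\<in>S. fscale (if K = J then 1 else 0) (pure (e K))) = (\<Sum>K\<in>S. if K = J then (pure (e K) :: 'b list \<Rightarrow>\<^sub>0 'a) else 0)"
          by (intro sum.cong) auto
        also have "\<dots> = pure (e J)" using that finS by simp
        finally have "pure (e J) - (\<Sum>K\<in>S. fscale (if K = J then 1 else 0) (pure (e K))) \<in> ?R"
          by (simp add: F.span_zero)
        then show ?thesis
          unfolding M_def by (intro CollectI exI[of _ "\<lambda>K. if K = J then 1 else 0"])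
      qed
    qed
    then have "x \<in> M" using x NF by blast
    then obtain c where c: "x - (\<Sum>J\<in>S. fscale (c J) (pure (e J))) \<in> ?R"
      by (auto simp: M_def)
    let ?y = "\<Sum>J\<in>S. fscale (c J) (pure (e J))"
    have "?y \<in> N"
      using F.subspace_diff[OF N x(1) subsetD[OF RN c]] by simp
    moreover have "?y \<notin> ?R"
      using F.span_add[OF c] x(2) by force
    ultimately obtain J where J: "J \<in> S" "pure (e J) \<in> N"
      using split[of S c] by blast
    then have "supported (tuples d) \<subseteq> N"
      using move by (intro generate N RN) blast
    then show ?thesis using NF by blast
  qed
qed

text \<open>
  The determinant of the coordinates with respect to \<open>us\<close> is a multilinear alternating functional
  that takes the value \<open>1\<close> on \<open>us\<close>. It is encoded with values in the free vector space on one
  generator, so that \<open>lin_ext_relations\<close> applies.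
\<close>
theorem basis_tuple_not_relation:
  assumes two: "(2::'a) \<noteq> 0"
    and us: "distinct us" "set us \<subseteq> Basis" "length us = d"
  shows "pure us \<notin> relations scale d"
proof
  define t where "t \<sigma> vs = (of_int (sign \<sigma>) :: 'a) * (\<Prod>i<d. representation Basis (vs ! i) (us ! \<sigma> i))"
    for \<sigma> and vs :: "'b list"
  define det where "det vs = (\<Sum>\<sigma> | \<sigma> permutes {..<d}. t \<sigma> vs)" for vs
  define h where "h vs = (Poly_Mapping.single () (det vs))" for vs
  have prod_update: "(\<Prod>i<d. representation Basis (vs[k := x] ! i) (us ! \<sigma> i)) =
      representation Basis x (us ! \<sigma> k) * (\<Prod>i\<in>{..<d} - {k}. representation Basis (vs ! i) (us ! \<sigma> i))"
    if "length vs = d" "k < d" for vs k x \<sigma>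
    using that by (subst prod.remove[of _ k]) (auto intro!: prod.cong)
  assume "pure us \<in> relations scale d"
  then have "lin_ext h (pure us) \<in> {0}"
  proof (rule lin_ext_relations[rotated -1])
    fix vs :: "'b list" and i x y assume vs: "length vs = d" "i < d"
    have "det (vs[i := x + y]) = det (vs[i := x]) + det (vs[i := y])"
      using vs by (simp add: det_def t_def prod_update representation_add independent_Basis span_Basis
          sum.distrib[symmetric] algebra_simps)
    then show "h (vs[i := x + y]) - (h (vs[i := x]) + h (vs[i := y])) \<in> {0}"
      by (simp add: h_def single_add)
  next
    fix vs :: "'b list" and i c x assume vs: "length vs = d" "i < d"
    have "det (vs[i := c *s x]) = c * det (vs[i := x])"
      using vs by (simp add: det_def t_def prod_update representation_scale independent_Basis span_Basis
          sum_distrib_left mult.assoc mult.left_commute)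
    then show "h (vs[i := c *s x]) - fscale c (h (vs[i := x])) \<in> {0}"
      by (simp add: h_def)
  next
    fix vs :: "'b list" and i j assume vs: "length vs = d" "i < d" "j < d" "i \<noteq> j" "vs ! i = vs ! j"
    \<comment> \<open>Composition with the transposition changes the sign of every term of the determinant.\<close>
    define \<tau> where "\<tau> = Transposition.transpose i j"
    have \<tau>: "\<tau> permutes {..<d}"
      unfolding \<tau>_def using vs by (intro permutes_swap_id) auto
    have vs\<tau>: "vs ! \<tau> k = vs ! k" for k
      using vs by (auto simp: \<tau>_def Transposition.transpose_def)
    have "t (\<sigma> \<circ> \<tau>) vs = - t \<sigma> vs" if \<sigma>: "\<sigma> permutes {..<d}" for \<sigma>
    proof -
      have "sign (\<sigma> \<circ> \<tau>) = - sign \<sigma>"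
        using \<sigma> \<tau> vs by (subst sign_compose) (auto simp: \<tau>_def sign_swap_id intro: permutation_permutes permutes_imp_permutation)
      moreover have "(\<Prod>k<d. representation Basis (vs ! k) (us ! (\<sigma> \<circ> \<tau>) k)) =
          (\<Prod>k<d. representation Basis (vs ! k) (us ! \<sigma> k))"
        using prod.permute[OF \<tau>, of "\<lambda>k. representation Basis (vs ! k) (us ! \<sigma> k)"]
        by (simp add: vs\<tau> o_def)
      ultimately show ?thesis by (simp add: t_def)
    qed
    then have "det vs = - det vs"
      unfolding det_def by (subst sum_permutations_compose_right[OF \<tau>]) (simp add: sum_negf)
    then have "2 * det vs = 0" by (metis add.right_inverse mult_2)
    then show "h vs \<in> {0}" using two by (simp add: h_def)
  qed simp
  moreover have "det us = 1"
  proof -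
    have "t \<sigma> us = (if \<sigma> = id then 1 else 0)" if \<sigma>: "\<sigma> permutes {..<d}" for \<sigma>
    proof (cases "\<sigma> = id")
      case True
      then show ?thesis
        using us by (simp add: t_def representation_basis independent_Basis subset_iff)
    next
      case False
      then obtain k where k: "\<sigma> k \<noteq> k" by (metis eq_id_iff)
      then have "k < d" using \<sigma> by (metis lessThan_iff permutes_not_in)
      moreover have "\<sigma> k < d" using \<open>k < d\<close> \<sigma> permutes_in_image by fastforce
      ultimately have "representation Basis (us ! k) (us ! \<sigma> k) = 0"
        using us k by (simp add: representation_basis independent_Basis subset_iff nth_eq_iff_index_eq)
      then show ?thesis
        using \<open>k < d\<close> False by (auto simp: t_def intro!: prod_zero)
    qed
    then have "det us = (\<Sum>\<sigma> | \<sigma> permutes {..<d}. if \<sigma> = id then 1 else 0)"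
      unfolding det_def by (intro sum.cong) auto
    then show ?thesis
      by (simp add: finite_permutations permutes_id)
  qed
  ultimately have "Poly_Mapping.single () (1::'a) = 0"
    by (simp add: h_def)
  then show False
    by (metis lookup_single_eq lookup_zero zero_neq_one)
qed

end

section \<open>Quotient modules\<close>

lemma carrier_ring_of_type_algebra [simp]: "carrier ring_of_type_algebra = UNIV"
  by (simp add: ring_of_type_algebra_def)

text \<open>
  This links the submodules of the record-based modules to the subspaces of the type-class
  vector spaces. The additive inverse of the record is defined by a description, which has to be
  identified with the unary minus.
\<close>
lemma submodule_iff_subspace:
  fixes M :: "('f::field, 'm::ab_group_add, 'e) module_scheme"
  assumes scl: "vector_space scl"
    and M: "add M = (+)" "zero M = 0" "module.smult M = scl"
    and C: "module.subspace scl (carrier M)"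
  shows "submodule N ring_of_type_algebra M \<longleftrightarrow> module.subspace scl N \<and> N \<subseteq> carrier M"
proof -
  interpret S: vector_space scl by fact
  show ?thesis
  proof
    assume "submodule N ring_of_type_algebra M"
    then interpret N: submodule N ring_of_type_algebra M .
    have "S.subspace N"
    proof (rule S.subspaceI)
      show "0 \<in> N" using N.one_closed M by simp
      show "x + y \<in> N" if "x \<in> N" "y \<in> N" for x y
        using N.m_closed[OF that] M by simp
      show "scl c x \<in> N" if "x \<in> N" for c x
        using N.smult_closed[of c x] that M by simp
    qed
    then show "S.subspace N \<and> N \<subseteq> carrier M"
      using N.subset by simp
  next
    assume N: "S.subspace N \<and> N \<subseteq> carrier M"
    have inv: "inv\<^bsub>add_monoid M\<^esub> x = - x" if "x \<in> N" for x
      unfolding m_inv_def using that N C S.subspace_neg[of "carrier M" x]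
      by (intro the_equality) (auto simp: M minus_unique)
    show "submodule N ring_of_type_algebra M"
    proof (intro submodule.intro subgroup.intro submodule_axioms.intro)
      show "inv\<^bsub>add_monoid M\<^esub> x \<in> N" if "x \<in> N" for x
        using that N by (simp add: inv S.subspace_neg)
    qed (use N in \<open>auto simp: M S.subspace_add S.subspace_0 S.subspace_scale\<close>)
  qed
qed

lemma free_module_simps [simp]:
  "carrier (free_module I) = supported I" "add (free_module I) = (+)" "zero (free_module I) = 0"
  "module.smult (free_module I) = fscale"
  by (simp_all add: free_module_def fscale_def fun_eq_iff)

lemma wedge_relations_eq: "wedge_relations scale d = relations scale d"
proof -
  have sub: "submodule N ring_of_type_algebra (free_module (tuples d)) \<longleftrightarrow> F.subspace N \<and> N \<subseteq> supported (tuples d)"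
    for N :: "('v list \<Rightarrow>\<^sub>0 'f::field) set"
    using submodule_iff_subspace[of fscale "free_module (tuples d)" N]
    by (simp add: F.vector_space_axioms subspace_supported)
  show ?thesis
    unfolding wedge_relations_def submodule_generated_def sub
  proof (intro equalityI Inter_lower Inter_greatest)
    show "relations scale d \<in> {N. (F.subspace N \<and> N \<subseteq> supported (tuples d)) \<and> wedge_relators scale d \<subseteq> N}"
      using relations_subset_tuples F.span_superset by blast
    show "relations scale d \<subseteq> N"
      if "N \<in> {N. (F.subspace N \<and> N \<subseteq> supported (tuples d)) \<and> wedge_relators scale d \<subseteq> N}" for N
      using that by (intro F.span_minimal) auto
  qed
qed

definition coset :: "('x \<Rightarrow>\<^sub>0 'a::field) set \<Rightarrow> ('x \<Rightarrow>\<^sub>0 'a) \<Rightarrow> ('x \<Rightarrow>\<^sub>0 'a) set" where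
  "coset K p = {q. q - p \<in> K}"

context
  fixes K :: "('x \<Rightarrow>\<^sub>0 'a::field) set"
  assumes K: "F.subspace K"
begin

lemma mem_coset [simp]: "p \<in> coset K p"
  using F.subspace_0[OF K] by (simp add: coset_def)

lemma coset_eq_iff: "coset K p = coset K q \<longleftrightarrow> p - q \<in> K"
proof
  assume "coset K p = coset K q"
  then show "p - q \<in> K"
    using mem_coset[of p] by (simp add: coset_def)
next
  assume pq: "p - q \<in> K"
  then have qp: "q - p \<in> K"
    using F.subspace_neg[OF K] by fastforce
  show "coset K p = coset K q"
    unfolding coset_def using F.subspace_diff_trans[OF K _ pq] F.subspace_diff_trans[OF K _ qp] by blast
qed

lemma coset_zero: "coset K 0 = K"
  by (simp add: coset_def)

lemma coset_free_module: "K +>\<^bsub>free_module I\<^esub> p = coset K p"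
proof -
  have "q \<in> (\<Union>h\<in>K. {h + p}) \<longleftrightarrow> q - p \<in> K" for q
    by (auto intro: bexI[of _ "q - p"])
  then show ?thesis
    by (auto simp: a_r_coset_def r_coset_def coset_def)
qed

lemma quotient_carrier: "carrier (quotient_module (free_module I) K) = coset K ` supported I"
  by (auto simp: quotient_module_def A_RCOSETS_def' coset_free_module)

lemma quotient_zero: "zero (quotient_module (free_module I) K) = coset K 0"
  by (simp add: quotient_module_def coset_zero)

lemma quotient_add: "coset K p \<oplus>\<^bsub>quotient_module (free_module I) K\<^esub> coset K q = coset K (p + q)"
proof -
  have "r \<in> {a + b |a b. a \<in> coset K p \<and> b \<in> coset K q} \<longleftrightarrow> r \<in> coset K (p + q)" for r
  proof
    assume "r \<in> {a + b |a b. a \<in> coset K p \<and> b \<in> coset K q}"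
    then obtain a b where "r = a + b" "a - p \<in> K" "b - q \<in> K"
      by (auto simp: coset_def)
    then show "r \<in> coset K (p + q)"
      using F.subspace_add[OF K, of "a - p" "b - q"] by (simp add: coset_def algebra_simps)
  next
    assume "r \<in> coset K (p + q)"
    then have "r = (r - q) + q \<and> r - q \<in> coset K p \<and> q \<in> coset K q"
      by (simp add: algebra_simps) (simp add: coset_def algebra_simps)
    then show "r \<in> {a + b |a b. a \<in> coset K p \<and> b \<in> coset K q}"
      by blast
  qed
  then show ?thesis
    by (simp add: quotient_module_def set_add_def') blast
qed

lemma quotient_smult: "c \<odot>\<^bsub>quotient_module (free_module I) K\<^esub> coset K p = coset K (fscale c p)"
proof -
  have eq: "coset K (fscale c q) = coset K (fscale c p)" if "q \<in> coset K p" for q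
    using that F.subspace_scale[OF K, of "q - p" c]
    by (simp add: coset_eq_iff F.scale_right_diff_distrib) (simp add: coset_def F.scale_right_diff_distrib)
  have "(\<Union>a\<in>coset K p. coset K (fscale c a)) = coset K (fscale c p)"
    by (rule UN_constant_eq[OF mem_coset ballI[OF eq]])
  then show ?thesis
    by (simp add: quotient_module_def coset_free_module)
qed

lemma quotient_action:
  assumes "\<And>p q. act w (p - q) = act w p - act w q" "\<And>p. p \<in> K \<Longrightarrow> act w p \<in> K"
  shows "quotient_action (free_module I) K act w (coset K p) = coset K (act w p)"
proof -
  have eq: "coset K (act w q) = coset K (act w p)" if "q \<in> coset K p" for q
    using that assms(2)[of "q - p"] by (simp add: coset_eq_iff assms(1)) (simp add: coset_def assms(1))
  have "(\<Union>a\<in>coset K p. coset K (act w a)) = coset K (act w p)"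
    by (rule UN_constant_eq[OF mem_coset ballI[OF eq]])
  then show ?thesis
    by (simp add: quotient_action_def coset_free_module)
qed

lemma quotient_module_module:
  "Module.module ring_of_type_algebra (quotient_module (free_module I) K)"
proof (rule moduleI)
  let ?M = "quotient_module (free_module I) K"
  show "cring (ring_of_type_algebra :: 'a ring)"
    by (rule cring_from_type_algebra)
  show "abelian_group ?M"
  proof (rule abelian_groupI)
    show "\<exists>y\<in>carrier ?M. y \<oplus>\<^bsub>?M\<^esub> x = \<zero>\<^bsub>?M\<^esub>" if x: "x \<in> carrier ?M" for x
    proof -
      obtain p where p: "x = coset K p" "p \<in> supported I"
        using x by (auto simp: quotient_carrier)
      then have "coset K (- p) \<in> carrier ?M"
        using F.subspace_neg[OF subspace_supported, of p I] by (auto simp: quotient_carrier)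
      then show ?thesis
        by (rule rev_bexI) (simp add: p quotient_add quotient_zero)
    qed
  qed (auto simp: quotient_carrier quotient_add quotient_zero add_ac dest!: subsetD[OF keys_add] intro!: imageI)
qed (auto simp: quotient_carrier quotient_add quotient_smult ring_of_type_algebra_def
  F.scale_left_distrib F.scale_right_distrib dest!: subsetD[OF keys_fscale] intro!: imageI)

text \<open>The correspondence between submodules of a quotient and subspaces that contain the kernel.\<close>
lemma submodule_quotient_preimage:
  assumes KI: "K \<subseteq> supported I"
    and N: "submodule N ring_of_type_algebra (quotient_module (free_module I) K)"
  defines "P \<equiv> {p \<in> supported I. coset K p \<in> N}"
  shows "F.subspace P" "K \<subseteq> P" "N = coset K ` P"
proof -
  let ?M = "quotient_module (free_module I) K"
  interpret N: submodule N ring_of_type_algebra ?M by (rule N)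
  have zero: "coset K 0 \<in> N"
    using N.one_closed by (simp add: quotient_zero)
  show "F.subspace P"
  proof (rule F.subspaceI)
    show "0 \<in> P" using zero by (simp add: P_def)
    show "p + q \<in> P" if "p \<in> P" "q \<in> P" for p q
      using that N.m_closed[of "coset K p" "coset K q"] F.subspace_add[OF subspace_supported, of p I q]
      by (simp add: P_def quotient_add)
    show "fscale c p \<in> P" if "p \<in> P" for c p
      using that N.smult_closed[of c "coset K p"] F.subspace_scale[OF subspace_supported, of p I c]
      by (simp add: P_def quotient_smult)
  qed
  show "K \<subseteq> P"
  proof
    fix p assume "p \<in> K"
    then have "coset K p = coset K 0" by (simp add: coset_eq_iff)
    then show "p \<in> P" using zero \<open>p \<in> K\<close> KI by (auto simp: P_def)
  qed
  show "N = coset K ` P"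
    using N.subset by (auto simp: P_def quotient_carrier)
qed

end

section \<open>Reflection representations\<close>

context finite_dimensional_vector_space
begin

text \<open>
  Some eigenvector \<open>b\<close> in a diagonalizing basis is moved by \<open>s\<close>. As \<open>s b - b\<close> is a multiple of both
  \<open>b\<close> and \<open>\<alpha>\<close>, the vectors \<open>b\<close> and \<open>\<alpha>\<close> are proportional, so \<open>\<alpha>\<close> is moved as well; this is
  where unipotent transvections are excluded.
\<close>
lemma reflection_functional:
  assumes s: "reflection scale s" and \<alpha>: "reflection_vector s \<alpha>" and eig: "s \<alpha> = lam *s \<alpha>"
  shows "\<exists>f. Vector_Spaces.linear scale (*) f \<and> (\<forall>v. s v = v + f v *s \<alpha>) \<and> f \<alpha> \<noteq> 0"
proof -
  interpret s: Vector_Spaces.linear scale scale s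
    using s by (simp add: reflection_def)
  have \<alpha>0: "\<alpha> \<noteq> 0" and \<alpha>im: "\<alpha> \<in> range (\<lambda>v. s v - v)"
    using \<alpha> by (auto simp: reflection_vector_def)
  have im: "range (\<lambda>v. s v - v) \<subseteq> span {\<alpha>}"
    using card_ge_dim_independent[of "{\<alpha>}" "range (\<lambda>v. s v - v)"] s \<alpha>0 \<alpha>im
    by (simp add: reflection_def)
  define f where "f v = (SOME c. s v - v = c *s \<alpha>)" for v
  have f: "s v - v = f v *s \<alpha>" for v
  proof -
    have "\<exists>c. s v - v = c *s \<alpha>"
      using im by (auto simp: span_singleton)
    then show ?thesis unfolding f_def by (rule someI_ex)
  qed
  have lin: "Vector_Spaces.linear scale (*) f"
  proof -
    have "f (x + y) *s \<alpha> = (f x + f y) *s \<alpha>" for x y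
      unfolding scale_left_distrib by (simp flip: f add: s.add)
    then have "f (x + y) = f x + f y" for x y
      using \<alpha>0 scale_cancel_right by blast
    moreover have "f (c *s x) *s \<alpha> = (c * f x) *s \<alpha>" for c x
      unfolding scale_scale[symmetric] by (simp flip: f add: s.scale scale_right_diff_distrib)
    then have "f (c *s x) = c * f x" for c x
      using \<alpha>0 scale_cancel_right by blast
    ultimately show ?thesis
      by unfold_locales (simp_all add: distrib_left mult.assoc distrib_right)
  qed
  have "f \<alpha> \<noteq> 0"
  proof
    assume "f \<alpha> = 0"
    then have s\<alpha>: "s \<alpha> = \<alpha>" using f[of \<alpha>] by simp
    obtain B where B: "\<not> dependent B" "span B = UNIV" "\<And>b. b \<in> B \<Longrightarrow> \<exists>c. s b = c *s b"
      using s by (auto simp: reflection_def diagonalizable_def)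
    have "s b = b" if b: "b \<in> B" for b
    proof (rule ccontr)
      assume sb: "s b \<noteq> b"
      obtain c where c: "s b = c *s b" using B(3) b by blast
      have fb: "f b \<noteq> 0" using f[of b] sb by auto
      have "f b *s \<alpha> = (c - 1) *s b"
        using f[of b] c by (simp add: scale_left_diff_distrib)
      then have \<alpha>b: "\<alpha> = (inverse (f b) * (c - 1)) *s b"
        using fb by (metis left_inverse scale_one scale_scale)
      have "c *s \<alpha> = s \<alpha>"
        by (subst (2) \<alpha>b, subst \<alpha>b) (simp add: s.scale c mult_ac)
      then have "c *s \<alpha> = 1 *s \<alpha>" using s\<alpha> by simp
      then have "c = 1" using \<alpha>0 scale_cancel_right by blast
      then show False using c sb by simp
    qed
    then have "s v = v" for v
    proof -
      have "v \<in> span B" using B(2) by simp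
      then show ?thesis
      proof (induction rule: span_induct)
        case base
        show ?case by (rule subspaceI) (auto simp: s.add s.scale)
      qed (use \<open>\<And>b. b \<in> B \<Longrightarrow> s b = b\<close> in auto)
    qed
    then show False using \<alpha>0 \<alpha>im by auto
  qed
  moreover have "s v = v + f v *s \<alpha>" for v
    using f[of v] by (simp add: algebra_simps)
  ultimately show ?thesis using lin by blast
qed

text \<open>
  Stability under the rank-one parts of the generators implies stability under all of \<open>W\<close>. For
  the inverse of a generator, either the vector is fixed, or the reflection vector lies
  in \<open>U\<close> and the vector changes only by a multiple of it.
\<close>
lemma irreducible_subspace_trivial:
  assumes irred: "irreducible_module W ring_of_type_algebra (module_of_vector_space scale) \<rho>"
    and gen: "generate W (s ` I) = carrier W"
    and refl: "\<And>i v. i \<in> I \<Longrightarrow> \<rho> (s i) v = v + f i v *s \<alpha> i"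
    and U: "subspace U" and stable: "\<And>i v. i \<in> I \<Longrightarrow> v \<in> U \<Longrightarrow> f i v *s \<alpha> i \<in> U"
  shows "U = {0} \<or> U = UNIV"
proof -
  let ?M = "module_of_vector_space scale"
  interpret M: group_module W ring_of_type_algebra ?M \<rho>
    using irred by (simp add: irreducible_module_def)
  have M [simp]: "carrier ?M = UNIV" "add ?M = (+)" "zero ?M = 0" "module.smult ?M = scale"
    by (simp_all add: module_of_vector_space_def)
  have "\<rho> w u \<in> U" if "w \<in> generate W (s ` I)" "u \<in> U" for w u
    using that
  proof (induction arbitrary: u rule: generate.induct)
    case one
    then show ?case using M.act_one by simp
  next
    case (incl w)
    then show ?case using stable U by (auto simp: refl intro!: subspace_add)
  next
    case (inv w)
    then obtain i where i: "i \<in> I" "w = s i" by blast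
    have w: "w \<in> carrier W" unfolding gen[symmetric] using inv(1) by (rule generate.incl)
    have right: "\<rho> w (\<rho> (inv\<^bsub>W\<^esub> w) u) = u"
      using M.act_mult[of w "inv\<^bsub>W\<^esub> w" u] M.act_one w by simp
    have left: "\<rho> (inv\<^bsub>W\<^esub> w) (\<rho> w u) = u"
      using M.act_mult[of "inv\<^bsub>W\<^esub> w" w u] M.act_one w by simp
    show ?case
    proof (cases "f i u = 0")
      case True
      then have "\<rho> w u = u" using refl i by simp
      then show ?thesis using left inv by simp
    next
      case False
      have "inverse (f i u) *s (f i u *s \<alpha> i) \<in> U"
        by (rule subspace_scale[OF U stable[OF i(1) inv(2)]])
      then have \<alpha>U: "\<alpha> i \<in> U" using False by simp
      have "\<rho> (inv\<^bsub>W\<^esub> w) u = u - f i (\<rho> (inv\<^bsub>W\<^esub> w) u) *s \<alpha> i"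
        using right refl[OF i(1)] i(2) by (metis add_diff_cancel_right')
      then show ?thesis
        using \<alpha>U inv U by (metis subspace_diff subspace_scale)
    qed
  next
    case (eng w w')
    then have "w \<in> carrier W" "w' \<in> carrier W" using gen by auto
    then show ?case using eng M.act_mult by simp
  qed
  moreover have "submodule U ring_of_type_algebra ?M"
    using U submodule_iff_subspace[of scale ?M U] by (simp add: vector_space_axioms)
  ultimately show ?thesis
    using irred gen by (auto simp: irreducible_module_def)
qed

end

section \<open>The action on the exterior powers\<close>

lemma free_action_diff: "free_action \<rho> w (p - q) = free_action \<rho> w p - free_action \<rho> w q"
  by (simp add: free_action_eq lin_ext_diff)

lemma free_action_supported:
  assumes "p \<in> supported (tuples d)"
  shows "free_action \<rho> w p \<in> supported (tuples d)"
  unfolding free_action_eq using assms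
  by (intro lin_ext_mem[OF subspace_supported]) auto

lemma free_action_relations:
  fixes scale :: "'f::field \<Rightarrow> 'v::ab_group_add \<Rightarrow> 'v"
  assumes lin: "Vector_Spaces.linear scale scale (\<rho> w)" and p: "p \<in> relations scale d"
  shows "free_action \<rho> w p \<in> relations scale d"
proof -
  interpret w: Vector_Spaces.linear scale scale "\<rho> w" by fact
  show ?thesis
    unfolding free_action_eq
  proof (rule lin_ext_relations[OF F.subspace_span _ _ _ p])
    fix vs :: "'v list" and i j x y c
    assume vs: "length vs = d" "i < d"
    show "pure (map (\<rho> w) (vs[i := x + y])) - (pure (map (\<rho> w) (vs[i := x])) + pure (map (\<rho> w) (vs[i := y])))
        \<in> relations scale d"
      using vs by (simp add: map_update w.add relations_add)
    show "pure (map (\<rho> w) (vs[i := scale c x])) - fscale c (pure (map (\<rho> w) (vs[i := x]))) \<in> relations scale d"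
      using relations_scale[of "map (\<rho> w) vs" d i scale c "\<rho> w x"] vs by (simp add: map_update w.scale)
    show "pure (map (\<rho> w) vs) \<in> relations scale d" if "j < d" "i \<noteq> j" "vs ! i = vs ! j"
      using vs that by (intro relations_alternating[of _ _ i j]) auto
  qed
qed

abbreviation wedge_class :: "('f::field \<Rightarrow> 'v::ab_group_add \<Rightarrow> 'v) \<Rightarrow> nat \<Rightarrow> ('v list \<Rightarrow>\<^sub>0 'f) \<Rightarrow> ('v list \<Rightarrow>\<^sub>0 'f) set" where
  "wedge_class scale d \<equiv> coset (relations scale d)"

lemma exterior_power_eq: "exterior_power scale d = quotient_module (free_module (tuples d)) (relations scale d)"
  by (simp add: exterior_power_def wedge_relations_eq)

lemmas exterior_power_simps =
  quotient_carrier[OF F.subspace_span[of "wedge_relators scale d"], of "tuples d", folded exterior_power_eq]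
  quotient_zero[OF F.subspace_span[of "wedge_relators scale d"], of "tuples d", folded exterior_power_eq]
  quotient_add[OF F.subspace_span[of "wedge_relators scale d"], of "tuples d", folded exterior_power_eq]
  quotient_smult[OF F.subspace_span[of "wedge_relators scale d"], of "tuples d", folded exterior_power_eq]
  for scale d

lemma exterior_action_wedge_class:
  assumes "Vector_Spaces.linear scale scale (\<rho> w)"
  shows "exterior_action scale \<rho> d w (wedge_class scale d p) = wedge_class scale d (free_action \<rho> w p)"
  unfolding exterior_action_def wedge_relations_eq
  by (rule quotient_action) (simp_all add: free_action_diff free_action_relations assms)

lemma exterior_group_module:
  fixes scale :: "'f::field \<Rightarrow> 'v::ab_group_add \<Rightarrow> 'v"
  assumes grp: "group W" and rep: "\<rho> \<in> hom W (general_linear_group scale)"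
  shows "group_module W ring_of_type_algebra (exterior_power scale d) (exterior_action scale \<rho> d)"
proof (rule group_module.intro)
  interpret W: group W by fact
  have lin: "Vector_Spaces.linear scale scale (\<rho> w)" if "w \<in> carrier W" for w
    using rep that by (auto simp: hom_def general_linear_group_def)
  have mult: "\<rho> (v \<otimes>\<^bsub>W\<^esub> w) = \<rho> v \<circ> \<rho> w" if "v \<in> carrier W" "w \<in> carrier W" for v w
    using rep that by (auto simp: hom_def general_linear_group_def)
  have one: "\<rho> \<one>\<^bsub>W\<^esub> = id"
  proof -
    have "\<rho> \<one>\<^bsub>W\<^esub> \<circ> \<rho> \<one>\<^bsub>W\<^esub> = \<rho> \<one>\<^bsub>W\<^esub>"
      using mult[of "\<one>\<^bsub>W\<^esub>" "\<one>\<^bsub>W\<^esub>"] by simp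
    moreover have "bij (\<rho> \<one>\<^bsub>W\<^esub>)"
      using rep W.one_closed by (auto simp: hom_def general_linear_group_def)
    ultimately show ?thesis
      by (metis bij_is_inj comp_apply eq_id_iff injD)
  qed
  show "group W" by fact
  show "Module.module ring_of_type_algebra (exterior_power scale d)"
    unfolding exterior_power_eq by (rule quotient_module_module) simp
  show "group_module_axioms W ring_of_type_algebra (exterior_power scale d) (exterior_action scale \<rho> d)"
  proof
    fix v w x y and c :: 'f
    assume w: "w \<in> carrier W" and x: "x \<in> carrier (exterior_power scale d)"
    from x obtain p where p: "x = wedge_class scale d p" "p \<in> supported (tuples d)"
      by (auto simp: exterior_power_simps)
    show "exterior_action scale \<rho> d w x \<in> carrier (exterior_power scale d)"
      unfolding p(1) exterior_action_wedge_class[of scale \<rho> w, OF lin[OF w]] exterior_power_simps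
      by (rule imageI[OF free_action_supported[OF p(2)]])
    show "exterior_action scale \<rho> d w (c \<odot>\<^bsub>exterior_power scale d\<^esub> x) = c \<odot>\<^bsub>exterior_power scale d\<^esub> exterior_action scale \<rho> d w x"
      by (simp add: p(1) exterior_action_wedge_class[of scale \<rho> w, OF lin[OF w]] exterior_power_simps free_action_eq lin_ext_scale)
    show "exterior_action scale \<rho> d w (x \<oplus>\<^bsub>exterior_power scale d\<^esub> y) =
        exterior_action scale \<rho> d w x \<oplus>\<^bsub>exterior_power scale d\<^esub> exterior_action scale \<rho> d w y"
      if "y \<in> carrier (exterior_power scale d)"
    proof -
      from that obtain q where q: "y = wedge_class scale d q"
        by (auto simp: exterior_power_simps)
      show ?thesis
        by (simp add: p(1) q exterior_action_wedge_class[of scale \<rho> w, OF lin[OF w]] exterior_power_simps free_action_eq lin_ext_add)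
    qed
    show "exterior_action scale \<rho> d (v \<otimes>\<^bsub>W\<^esub> w) x = exterior_action scale \<rho> d v (exterior_action scale \<rho> d w x)"
      if v: "v \<in> carrier W"
    proof -
      have "free_action \<rho> (v \<otimes>\<^bsub>W\<^esub> w) p = free_action \<rho> v (free_action \<rho> w p)"
        by (simp add: free_action_eq lin_ext_comp mult[OF v w])
      then show ?thesis
        using v w by (simp add: p(1) exterior_action_wedge_class lin)
    qed
  next
    fix x assume "x \<in> carrier (exterior_power scale d)"
    then obtain p where p: "x = wedge_class scale d p"
      by (auto simp: exterior_power_simps)
    show "exterior_action scale \<rho> d \<one>\<^bsub>W\<^esub> x = x"
      by (simp add: p exterior_action_wedge_class[of scale \<rho> "\<one>\<^bsub>W\<^esub>", OF lin[OF W.one_closed]] free_action_eq one lin_ext_pure)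
  qed
qed

theorem theorem1p2:
  fixes scale :: "'f::field_char_0 \<Rightarrow> 'v::ab_group_add \<Rightarrow> 'v"
    and Basis :: "'v set"
    and n k :: nat
    and W :: "('w, 'c) monoid_scheme"
    and \<rho> :: "'w \<Rightarrow> 'v \<Rightarrow> 'v"
    and s :: "nat \<Rightarrow> 'w"
    and \<alpha> :: "nat \<Rightarrow> 'v"
    and lam :: "nat \<Rightarrow> 'f"
  assumes fin_dim: "finite_dimensional_vector_space scale Basis"
    and dim_V: "vector_space.dim scale (UNIV :: 'v set) = n"
    and grp: "group W"
    and rep: "\<rho> \<in> hom W (general_linear_group scale)"
    and k_pos: "k \<ge> 1"
    and s_in_W: "\<And>i. i \<in> {1..k} \<Longrightarrow> s i \<in> carrier W"
    and refl: "\<And>i. i \<in> {1..k} \<Longrightarrow> reflection scale (\<rho> (s i))"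
    and refl_vec: "\<And>i. i \<in> {1..k} \<Longrightarrow> reflection_vector (\<rho> (s i)) (\<alpha> i)"
    and eigenvalue: "\<And>i. i \<in> {1..k} \<Longrightarrow> \<rho> (s i) (\<alpha> i) = scale (lam i) (\<alpha> i)"
    and gen: "generate W (s ` {1..k}) = carrier W"
    and irred: "irreducible_module W ring_of_type_algebra (module_of_vector_space scale) \<rho>"
    and fixing_symmetric: "\<And>i j. i \<in> {1..k} \<Longrightarrow> j \<in> {1..k} \<Longrightarrow>
           \<rho> (s i) (\<alpha> j) \<noteq> \<alpha> j \<longleftrightarrow> \<rho> (s j) (\<alpha> i) \<noteq> \<alpha> i"
  shows "(\<forall>d\<le>n. irreducible_module W ring_of_type_algebra
           (exterior_power scale d) (exterior_action scale \<rho> d)) \<and>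
         (\<forall>d\<le>n. \<forall>e\<le>n. d \<noteq> e \<longrightarrow>
            \<not> isomorphic_modules W ring_of_type_algebra
                (exterior_power scale d) (exterior_action scale \<rho> d)
                (exterior_power scale e) (exterior_action scale \<rho> e))"
proof -
  interpret finite_dimensional_vector_space scale Basis by fact
  let ?K = "ring_of_type_algebra :: 'f ring"
  let ?E = "exterior_power scale" and ?act = "exterior_action scale \<rho>"
  have lin: "Vector_Spaces.linear scale scale (\<rho> w)" if "w \<in> carrier W" for w
    using rep that by (auto simp: hom_def general_linear_group_def)
  have card: "card Basis = n"
    using dim_V dim_UNIV by simp
  have two: "(2::'f) \<noteq> 0" by simp
  have "\<exists>f. \<forall>i\<in>{1..k}. Vector_Spaces.linear scale (*) (f i) \<and>
      (\<forall>v. \<rho> (s i) v = v + scale (f i v) (\<alpha> i)) \<and> f i (\<alpha> i) \<noteq> 0"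
    by (intro bchoice ballI reflection_functional[OF refl refl_vec eigenvalue])
  then obtain f where f: "\<And>i. i \<in> {1..k} \<Longrightarrow> Vector_Spaces.linear scale (*) (f i)"
      "\<And>i v. i \<in> {1..k} \<Longrightarrow> \<rho> (s i) v = v + scale (f i v) (\<alpha> i)"
      "\<And>i. i \<in> {1..k} \<Longrightarrow> f i (\<alpha> i) \<noteq> 0"
    by blast
  have sym: "f i (\<alpha> j) = 0 \<longleftrightarrow> f j (\<alpha> i) = 0" if "i \<in> {1..k}" "j \<in> {1..k}" for i j
    using fixing_symmetric[OF that] refl_vec[OF that(1)] refl_vec[OF that(2)] that
    by (simp add: f(2) reflection_vector_def)
  \<comment> \<open>The passage from the group to the Lie algebra; it is used once for a submodule and once for
      the graph of an isomorphism.\<close>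
  have D: "derivation A p \<in> N"
    if N: "contains_relations scale N"
      and stable: "\<And>i p. i \<in> {1..k} \<Longrightarrow> p \<in> N \<Longrightarrow> free_action \<rho> (s i) p \<in> N"
      and A: "Vector_Spaces.linear scale scale A" and p: "p \<in> N" for N A p
  proof (rule derivation_stable[OF two _ f(1,3) sym _ N _ A p, of "{1..k}"])
    show "{1..k} \<noteq> {}" using k_pos by simp
    show "U = {0} \<or> U = UNIV"
      if "subspace U" "\<And>i v. i \<in> {1..k} \<Longrightarrow> v \<in> U \<Longrightarrow> scale (f i v) (\<alpha> i) \<in> U" for U
      using irreducible_subspace_trivial[OF irred gen f(2) that] .
    show "lin_ext (\<lambda>vs. pure (map (\<lambda>v. v + scale (f i v) (\<alpha> i)) vs)) p \<in> N"
      if "i \<in> {1..k}" "p \<in> N" for i p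
      using stable[OF that] by (simp add: free_action_eq f(2)[OF that(1), abs_def])
  qed
  have nonzero: "\<exists>us. length us = d \<and> pure us \<notin> relations scale d" if "d \<le> n" for d
  proof -
    obtain bs where bs: "set bs = Basis" "distinct bs"
      using finite_distinct_list[OF finite_Basis] by blast
    then have "length bs = n" using card distinct_card by force
    then have "length (take d bs) = d" using that by simp
    moreover from this have "pure (take d bs) \<notin> relations scale d"
      using bs set_take_subset[of d bs] by (intro basis_tuple_not_relation[OF two]) auto
    ultimately show ?thesis by blast
  qed
  have irreducible: "irreducible_module W ?K (?E d) (?act d)" if d: "d \<le> n" for d
    unfolding irreducible_module_def
  proof (intro conjI allI impI)
    show "group_module W ?K (?E d) (?act d)"
      by (rule exterior_group_module[OF grp rep])
    obtain us where us: "length us = d" "pure us \<notin> relations scale d"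
      using nonzero[OF d] by blast
    have "wedge_class scale d (pure us) \<in> carrier (?E d)"
      unfolding exterior_power_simps using us(1) by (intro imageI) simp
    moreover have "wedge_class scale d (pure us) \<noteq> zero (?E d)"
      unfolding exterior_power_simps using us(2) by (simp add: coset_eq_iff)
    ultimately show "carrier (?E d) \<noteq> {zero (?E d)}" by blast
    fix N assume N: "submodule N ?K (?E d) \<and> (\<forall>w\<in>carrier W. \<forall>x\<in>N. ?act d w x \<in> N)"
    define P where "P = {p \<in> supported (tuples d). wedge_class scale d p \<in> N}"
    have P: "F.subspace P" "relations scale d \<subseteq> P" "N = wedge_class scale d ` P"
      using submodule_quotient_preimage[OF F.subspace_span relations_subset_tuples] N
      unfolding exterior_power_eq P_def by blast+
    have "contains_relations scale P"
      unfolding contains_relations_def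
    proof (intro conjI ballI P(1))
      fix p vs assume "p \<in> P" "vs \<in> Poly_Mapping.keys p"
      then have "length vs = d" by (auto simp: P_def)
      then show "wedge_relators scale (length vs) \<subseteq> P"
        using F.span_superset[of "wedge_relators scale d"] P(2) by blast
    qed
    moreover have "free_action \<rho> (s i) p \<in> P" if i: "i \<in> {1..k}" and p: "p \<in> P" for i p
    proof -
      have "wedge_class scale d (free_action \<rho> (s i) p) = ?act d (s i) (wedge_class scale d p)"
        using exterior_action_wedge_class[of scale \<rho> "s i", OF lin[OF s_in_W[OF i]]] by simp
      then show ?thesis
        using N p s_in_W[OF i] free_action_supported[of p d \<rho> "s i"] unfolding P_def by simp
    qed
    ultimately have "P = relations scale d \<or> P = supported (tuples d)"
      by (intro gl_submodule_trivial[OF P(1,2)] D) (auto simp: P_def)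
    then show "N = {zero (?E d)} \<or> N = carrier (?E d)"
    proof
      assume "P = relations scale d"
      then have "wedge_class scale d p = zero (?E d)" if "p \<in> P" for p
        using that by (simp add: exterior_power_simps coset_eq_iff)
      moreover have "P \<noteq> {}" using F.subspace_0[OF P(1)] by blast
      ultimately show ?thesis unfolding P(3) by auto
    next
      assume "P = supported (tuples d)"
      then show ?thesis unfolding P(3) by (simp add: exterior_power_simps)
    qed
  qed
  moreover have "\<not> isomorphic_modules W ?K (?E d) (?act d) (?E e) (?act e)"
    if de: "e \<le> n" "d \<noteq> e" for d e
  proof
    assume "isomorphic_modules W ?K (?E d) (?act d) (?E e) (?act e)"
    then obtain \<phi> where \<phi>: "\<phi> \<in> Group.iso (add_monoid (?E d)) (add_monoid (?E e))"
      and \<phi>_smult: "\<And>c x. x \<in> carrier (?E d) \<Longrightarrow> \<phi> (c \<odot>\<^bsub>?E d\<^esub> x) = c \<odot>\<^bsub>?E e\<^esub> \<phi> x"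
      and \<phi>_act: "\<And>w x. w \<in> carrier W \<Longrightarrow> x \<in> carrier (?E d) \<Longrightarrow> \<phi> (?act d w x) = ?act e w (\<phi> x)"
      unfolding isomorphic_modules_def by auto
    have \<phi>_add: "\<phi> (x \<oplus>\<^bsub>?E d\<^esub> y) = \<phi> x \<oplus>\<^bsub>?E e\<^esub> \<phi> y" if "x \<in> carrier (?E d)" "y \<in> carrier (?E d)" for x y
      using \<phi> that by (auto simp: Group.iso_def hom_def)
    have \<phi>_surj: "\<phi> ` carrier (?E d) = carrier (?E e)"
      using \<phi> by (auto simp: Group.iso_def bij_betw_def)
    have carrier: "wedge_class scale d p \<in> carrier (?E d)" if "p \<in> supported (tuples d)" for p d
      using that by (simp add: exterior_power_simps)
    have \<phi>_zero: "\<phi> (wedge_class scale d 0) = wedge_class scale e 0"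
    proof -
      have 0: "wedge_class scale d 0 \<in> carrier (?E d)"
        by (rule carrier) simp
      then have "\<phi> (wedge_class scale d 0) \<in> carrier (?E e)"
        using \<phi>_surj by blast
      then obtain y where "\<phi> (wedge_class scale d 0) = wedge_class scale e y"
        unfolding exterior_power_simps by blast
      then show ?thesis
        using \<phi>_smult[OF 0, of 0] by (simp add: exterior_power_simps)
    qed
    \<comment> \<open>The graph of \<open>\<phi>\<close>, pulled back to the free vector space. The two components live in different
        degrees, so their sum determines them.\<close>
    define \<Gamma> where "\<Gamma> = {x + y |x y. x \<in> supported (tuples d) \<and> y \<in> supported (tuples e) \<and>
        \<phi> (wedge_class scale d x) = wedge_class scale e y}"
    have \<Gamma>I: "x + y \<in> \<Gamma>" if "x \<in> supported (tuples d)" "y \<in> supported (tuples e)"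
      "\<phi> (wedge_class scale d x) = wedge_class scale e y" for x y
      using that unfolding \<Gamma>_def by blast
    have sub: "F.subspace \<Gamma>"
    proof (rule F.subspaceI)
      show "0 \<in> \<Gamma>"
        using \<Gamma>I[of 0 0] \<phi>_zero by simp
      show "p + q \<in> \<Gamma>" if pq: "p \<in> \<Gamma>" "q \<in> \<Gamma>" for p q
      proof -
        obtain x y x' y' where xy: "p = x + y" "q = x' + y'"
            "x \<in> supported (tuples d)" "x' \<in> supported (tuples d)"
            "y \<in> supported (tuples e)" "y' \<in> supported (tuples e)"
            "\<phi> (wedge_class scale d x) = wedge_class scale e y"
            "\<phi> (wedge_class scale d x') = wedge_class scale e y'"
          using pq unfolding \<Gamma>_def by blast
        have "(x + x') + (y + y') \<in> \<Gamma>"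
        proof (rule \<Gamma>I)
          show "\<phi> (wedge_class scale d (x + x')) = wedge_class scale e (y + y')"
            using \<phi>_add[OF carrier[OF xy(3)] carrier[OF xy(4)]] xy(7,8) by (simp add: exterior_power_simps)
        qed (use xy in \<open>auto dest!: subsetD[OF keys_add]\<close>)
        then show ?thesis by (simp add: xy add_ac)
      qed
      show "fscale c p \<in> \<Gamma>" if p: "p \<in> \<Gamma>" for c p
      proof -
        obtain x y where xy: "p = x + y" "x \<in> supported (tuples d)" "y \<in> supported (tuples e)"
            "\<phi> (wedge_class scale d x) = wedge_class scale e y"
          using p unfolding \<Gamma>_def by blast
        have "fscale c x + fscale c y \<in> \<Gamma>"
        proof (rule \<Gamma>I)
          show "\<phi> (wedge_class scale d (fscale c x)) = wedge_class scale e (fscale c y)"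
            using \<phi>_smult[OF carrier[OF xy(2)], of c] xy(4) by (simp add: exterior_power_simps)
        qed (use xy in \<open>auto dest!: subsetD[OF keys_fscale]\<close>)
        then show ?thesis by (simp add: xy F.scale_right_distrib)
      qed
    qed
    have rel_d: "wedge_relators scale d \<subseteq> \<Gamma>"
    proof
      fix r assume "r \<in> wedge_relators scale d"
      then have r: "r \<in> relations scale d" by (rule F.span_base)
      then have r': "r \<in> supported (tuples d)" using relations_subset_tuples by blast
      from r have "wedge_class scale d r = wedge_class scale d 0" by (simp add: coset_eq_iff)
      then have "r + 0 \<in> \<Gamma>"
        using r' \<phi>_zero by (intro \<Gamma>I) auto
      then show "r \<in> \<Gamma>" by simp
    qed
    have rel_e: "wedge_relators scale e \<subseteq> \<Gamma>"
    proof
      fix r assume "r \<in> wedge_relators scale e"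
      then have r: "r \<in> relations scale e" by (rule F.span_base)
      then have r': "r \<in> supported (tuples e)" using relations_subset_tuples by blast
      from r have "wedge_class scale e r = wedge_class scale e 0" by (simp add: coset_eq_iff)
      then have "0 + r \<in> \<Gamma>"
        using r' \<phi>_zero by (intro \<Gamma>I) auto
      then show "r \<in> \<Gamma>" by simp
    qed
    have rel: "contains_relations scale \<Gamma>"
      unfolding contains_relations_def
    proof (intro conjI ballI sub)
      fix p vs assume "p \<in> \<Gamma>" "vs \<in> Poly_Mapping.keys p"
      then have "length vs = d \<or> length vs = e"
        unfolding \<Gamma>_def by (auto dest!: subsetD[OF keys_add])
      then show "wedge_relators scale (length vs) \<subseteq> \<Gamma>"
        using rel_d rel_e by auto
    qed
    have stable: "free_action \<rho> (s i) p \<in> \<Gamma>" if i: "i \<in> {1..k}" and p: "p \<in> \<Gamma>" for i p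
    proof -
      obtain x y where xy: "p = x + y" "x \<in> supported (tuples d)" "y \<in> supported (tuples e)"
          "\<phi> (wedge_class scale d x) = wedge_class scale e y"
        using p unfolding \<Gamma>_def by blast
      have "free_action \<rho> (s i) x + free_action \<rho> (s i) y \<in> \<Gamma>"
      proof (rule \<Gamma>I)
        show "\<phi> (wedge_class scale d (free_action \<rho> (s i) x)) = wedge_class scale e (free_action \<rho> (s i) y)"
          using \<phi>_act[OF s_in_W[OF i] carrier[OF xy(2)]] xy(4)
            exterior_action_wedge_class[of scale \<rho> "s i", OF lin[OF s_in_W[OF i]]] by simp
      qed (rule free_action_supported, fact xy)+
      then show ?thesis by (simp add: xy free_action_eq lin_ext_add)
    qed
    obtain us where us: "length us = e" "pure us \<notin> relations scale e"
      using nonzero[OF de(1)] by blast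
    let ?y = "pure us :: 'v list \<Rightarrow>\<^sub>0 'f"
    have y: "?y \<in> supported (tuples e)" using us by simp
    have "wedge_class scale e ?y \<in> \<phi> ` carrier (?E d)"
      using \<phi>_surj carrier[OF y] by blast
    then obtain x where x: "x \<in> supported (tuples d)" "\<phi> (wedge_class scale d x) = wedge_class scale e ?y"
      unfolding exterior_power_simps by force
    \<comment> \<open>The derivation of the identity multiplies \<open>x\<close> by \<open>d\<close> and \<open>?y\<close> by \<open>e\<close>. Eliminating \<open>x\<close> puts
        \<open>?y\<close> alone into the graph, so it represents the image of zero.\<close>
    have "derivation (\<lambda>v. v) (x + ?y) \<in> \<Gamma>"
      by (rule D[OF rel stable linear_ident \<Gamma>I[OF x(1) y x(2)]])
    then have "fscale (of_nat d) x + fscale (of_nat e) ?y \<in> \<Gamma>"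
      using derivation_id[OF x(1)[simplified]] derivation_id[of ?y e] us
      by (simp add: derivation_def lin_ext_add)
    from F.subspace_diff[OF sub this F.subspace_scale[OF sub \<Gamma>I[OF x(1) y x(2)], of "of_nat d"]]
    have "fscale (of_nat e - of_nat d) ?y \<in> \<Gamma>"
      by (simp add: F.scale_right_distrib F.scale_left_diff_distrib del: fscale_single)
    from F.subspace_scale[OF sub this, of "inverse (of_nat e - of_nat d)"]
    have "?y \<in> \<Gamma>"
      using de by simp
    then obtain x' y' where xy': "?y = x' + y'" "x' \<in> supported (tuples d)" "y' \<in> supported (tuples e)"
        "\<phi> (wedge_class scale d x') = wedge_class scale e y'"
      unfolding \<Gamma>_def by blast
    have "x' \<in> supported (tuples e)"
    proof -
      have "x' = ?y - y'" using xy'(1) by simp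
      then show ?thesis using F.subspace_diff[OF subspace_supported y xy'(3)] by simp
    qed
    moreover have "tuples d \<inter> tuples e = ({} :: 'v list set)"
      using de(2) by auto
    ultimately have "Poly_Mapping.keys x' = {}"
      using xy'(2) by blast
    then have "x' = 0" by simp
    then have "wedge_class scale e ?y = wedge_class scale e 0"
      using xy' \<phi>_zero by simp
    then show False
      using us by (simp add: coset_eq_iff)
  qed
  ultimately show ?thesis by blast
qed

end
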